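(* Let $t\in[0,T]$ and let $\zeta\in L^\infty(\Omega,\mathcal{F}_t,P)$ be such that $\zeta\circ\tau_\ell=\zeta$, $P$-a.e., for every natural number $\ell\ge1$, where $\tau_\ell:\Omega\to\Omega$ are the transformations of the Wiener–Poisson space defined in the context. Then there exists a real number $C$ such that $\zeta=C$, $P$-a.s.
   Context: **Probability space.** $\Omega_1=C_0(\mathbb{R};\mathbb{R}^d)$ is the set of continuous functions $\mathbb{R}\to\mathbb{R}^d$ vanishing at $0$ (topology of uniform convergence on compacts), and $P_1$ is the Wiener measure on its completed Borel $\sigma$-algebra $\mathcal{F}_1$, under which the coordinate processes $B_s(\omega)=\omega(s)$ and $B_{-s}(\omega)=\omega(-s)$, $s\ge 0$, are two independent $d$-dimensional Brownian motions. $E=\mathbb{R}^{m}\setminus\{0\}$ with Borel $\sigma$-field $\mathcal{B}(E)$; $\lambda$ is a $\sigma$-finite measure on $E$ with $\int_E(1\wedge|e|^2)\lambda(de)<\infty$. $\Omega_2$ is the set of point functions $p:D_p\to E$ with $D_p\subset\mathbb{R}$ countable; $\mu(p,(s,t]\times\Delta)=\#\{r\in D_p\cap(s,t]:p(r)\in\Delta\}$; $\mathcal{F}_2$ is generated by all maps $p\mapsto\mu(p,(s,t]\times\Delta)$, $s<t$, $\Delta\in\mathcal{B}(E)$, and completed under the probability $P_2$ for which $\mu$ is a Poisson random measure on $\mathbb{R}\times E$ with compensator $dt\,\lambda(de)$. $(\Omega,\mathcal{F},P)$ is the completed product of the two spaces. For $t\ge0$, $\mathcal{F}^B_t=\sigma\{B_r:r\le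 t\}$ (all $r\in(-\infty,t]$), augmented by null sets; $\mathcal{F}^\mu_t=\bigcap_{s>t}\sigma\{\mu((q,r]\times\Delta):-\infty<q\le r\le s,\Delta\in\mathcal{B}(E)\}$, augmented by null sets; $\mathcal{F}_t=\mathcal{F}^B_t\otimes\mathcal{F}^\mu_t$ augmented by the $P$-null sets. $T>0$ is fixed. **The transformations $\tau_\ell$** (for the given $t$). For $\omega_1\in\Omega_1$ write $\omega_1((s,r]):=\omega_1(r)-\omega_1(s)$. For $\ell\ge1$, $\tau'_\ell:\Omega_1\to\Omega_1$ is defined by $$(\tau'_\ell\omega_1)((t-\ell,r])=\omega_1((t-2\ell,r-\ell]),\qquad(\tau'_\ell\omega_1)((t-2\ell,r-\ell])=\omega_1((t-\ell,r]),\qquad r\in[t-\ell,t],$$ $$(\tau'_\ell\omega_1)((s,r])=\omega_1((s,r])\ \text{ if }(s,r]\cap(t-2\ell,t]=\emptyset,\qquad(\tau'_\ell\omega_1)(0)=0$$ (i.e. the increments over $(t-2\ell,t-\ell]$ and $(t-\ell,t]$ are exchanged). $\tau''_\ell:\Omega_2\to\Omega_2$ maps $p$ to the point function obtained by leaving the points of $p$ at times in $D_p\setminus(t-2\ell,t]$ unchanged, moving each point at time $r\in D_p\cap(t-\ell,t]$ to time $r-\ell$, and each point at time $r\in D_p\cap(t-2\ell,t-\ell]$ to time $r+\ell$ (keeping the values $p(r)$). Finally $\tau_\ell(\omega_1,p):=(\tau'_\ell\omega_1,\tau''_\ell p)$ for $(\omega_1,p)\in\Omega=\Omega_1\times\Omega_2$.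 *)

theory Defs
  imports "HOL-Probability.Probability"
begin

definition sigma_gen :: "'a set \<Rightarrow> 'i set \<Rightarrow> ('i \<Rightarrow> 'a \<Rightarrow> 'b::topological_space) \<Rightarrow> 'a measure" where
  "sigma_gen \<Omega> I X = sigma \<Omega> (\<Union>i\<in>I. {X i -` A \<inter> \<Omega> | A. A \<in> sets borel})"

text \<open>Only the sets of \<open>G\<close> matter; the result carries the zero measure, as does \<^const>\<open>sigma_gen\<close>.\<close>

definition augment :: "'a measure \<Rightarrow> 'a measure \<Rightarrow> 'a measure" where
  "augment P G = sigma (space P) (sets G \<union> null_sets P)"

definition C0 :: "(real \<Rightarrow> real^'d) set" where
  "C0 = {w. continuous_on UNIV w \<and> w 0 = 0}"

definition ucc_topology :: "(real \<Rightarrow> real^'d) topology" where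
  "ucc_topology = topology_generated_by
     {{g \<in> C0. \<forall>x\<in>K. dist (f x) (g x) < e} | f K e. f \<in> C0 \<and> compact K \<and> 0 < e}"

lemma topspace_ucc_topology: "topspace ucc_topology = C0"
proof -
  have "C0 = {g \<in> C0. \<forall>x\<in>{}. dist ((\<lambda>_. 0) x) (g x) < (1::real)}" by simp
  moreover have "(\<lambda>_. 0) \<in> (C0 :: (real \<Rightarrow> real^'d) set)" by (simp add: C0_def)
  ultimately have "(C0 :: (real \<Rightarrow> real^'d) set) \<in>
      {{g \<in> C0. \<forall>x\<in>K. dist (f x) (g x) < e} | f K e. f \<in> C0 \<and> compact K \<and> 0 < e}"
    by (auto intro!: exI[of _ "{}"] exI[of _ "1::real"] exI[of _ "\<lambda>_. 0"])
  then show ?thesis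
    by (auto simp: ucc_topology_def topology_generated_by_topspace)
qed

text \<open>Standard \<open>d\<close>-dimensional Brownian motion on the time set \<open>{0..}\<close>.\<close>

definition brownian_motion :: "'a measure \<Rightarrow> (real \<Rightarrow> 'a \<Rightarrow> real^'d) \<Rightarrow> bool" where
  "brownian_motion P X \<longleftrightarrow>
     prob_space P \<and>
     (\<forall>s\<ge>0. X s \<in> borel_measurable P) \<and>
     (AE \<omega> in P. X 0 \<omega> = 0) \<and>
     (AE \<omega> in P. continuous_on {0..} (\<lambda>s. X s \<omega>)) \<and>
     (\<forall>s u. 0 \<le> s \<and> s < u \<longrightarrow>
        distributed P lborel (\<lambda>\<omega>. X u \<omega> - X s \<omega>)
          (\<lambda>x. ennreal (\<Prod>i\<in>UNIV. normal_density 0 (sqrt (u - s)) (x $ i)))) \<and>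
     (\<forall>n (u :: nat \<Rightarrow> real). 0 \<le> u 0 \<and> (\<forall>i<n. u i < u (Suc i)) \<longrightarrow>
        prob_space.indep_vars P (\<lambda>_. borel) (\<lambda>i \<omega>. X (u (Suc i)) \<omega> - X (u i) \<omega>) {..<n})"

text \<open>Wiener measure on the uncompleted Borel sigma-algebra; it is completed where it is used.\<close>

definition wiener_measure :: "(real \<Rightarrow> real^'d) measure \<Rightarrow> bool" where
  "wiener_measure W \<longleftrightarrow>
     prob_space W \<and>
     space W = C0 \<and>
     sets W = sets (sigma C0 {U. openin ucc_topology U}) \<and>
     brownian_motion W (\<lambda>s \<omega>. \<omega> s) \<and>
     brownian_motion W (\<lambda>s \<omega>. \<omega> (- s)) \<and>
     prob_space.indep_var W
       (PiM {0..} (\<lambda>_. borel)) (\<lambda>\<omega>. \<lambda>s\<in>{0..}. \<omega> s)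
       (PiM {0..} (\<lambda>_. borel)) (\<lambda>\<omega>. \<lambda>s\<in>{0..}. \<omega> (- s))"

abbreviation borel_nz :: "(real^'m) measure" where
  "borel_nz \<equiv> restrict_space borel (UNIV - {0})"

text \<open>A point function \<open>p : D\<^sub>p \<rightarrow> E\<close> is a partial map with domain \<open>D\<^sub>p\<close>.\<close>

definition point_functions :: "(real \<rightharpoonup> real^'m) set" where
  "point_functions = {p. countable (dom p) \<and> ran p \<subseteq> UNIV - {0}}"

definition point_count :: "(real \<rightharpoonup> 'e) \<Rightarrow> (real \<times> 'e) set \<Rightarrow> ennreal" where
  "point_count p A = emeasure (count_space UNIV) {r. \<exists>e. p r = Some e \<and> (r, e) \<in> A}"

definition poisson_random_measure :: "'a measure \<Rightarrow> ('a \<Rightarrow> 'b set \<Rightarrow> ennreal) \<Rightarrow> 'b measure \<Rightarrow> bool" where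
  "poisson_random_measure P N \<nu> \<longleftrightarrow>
     prob_space P \<and>
     (\<forall>A\<in>sets \<nu>. (\<lambda>\<omega>. N \<omega> A) \<in> borel_measurable P) \<and>
     (\<forall>A\<in>sets \<nu>. emeasure \<nu> A < \<infinity> \<longrightarrow>
        (\<forall>k::nat. measure P {\<omega> \<in> space P. N \<omega> A = of_nat k}
                  = measure \<nu> A ^ k / fact k * exp (- measure \<nu> A))) \<and>
     (\<forall>A\<in>sets \<nu>. emeasure \<nu> A = \<infinity> \<longrightarrow> (AE \<omega> in P. N \<omega> A = \<infinity>)) \<and>
     (\<forall>n (A :: nat \<Rightarrow> 'b set). A ` {..<n} \<subseteq> sets \<nu> \<and> disjoint_family_on A {..<n} \<longrightarrow>
        prob_space.indep_vars P (\<lambda>_. borel) (\<lambda>i \<omega>. N \<omega> (A i)) {..<n})"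

text \<open>
  The Poisson property is required of the completion of \<open>Q\<close>: for a general Borel set \<open>A\<close>,
  \<open>p \<mapsto> point_count p A\<close> need not be measurable for the sigma-algebra generated by the counts of
  rectangles, because a point function may have infinitely many points in every rectangle.
\<close>

definition poisson_space :: "(real^'m) measure \<Rightarrow> (real \<rightharpoonup> real^'m) measure \<Rightarrow> bool" where
  "poisson_space lam Q \<longleftrightarrow>
     space Q = point_functions \<and>
     sets Q = sets (sigma_gen point_functions {(s, u, D). s < u \<and> D \<in> sets borel_nz}
                      (\<lambda>(s, u, D) p. point_count p ({s<..u} \<times> D))) \<and>
     poisson_random_measure (completion Q) point_count (lborel \<Otimes>\<^sub>M lam)"

definition wp_space ::
  "(real \<Rightarrow> real^'d) measure \<Rightarrow> (real \<rightharpoonup> real^'m) measure \<Rightarrow>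
   ((real \<Rightarrow> real^'d) \<times> (real \<rightharpoonup> real^'m)) measure" where
  "wp_space W Q = completion (completion W \<Otimes>\<^sub>M completion Q)"

definition filt_B :: "(real \<Rightarrow> real^'d) measure \<Rightarrow> real \<Rightarrow> (real \<Rightarrow> real^'d) measure" where
  "filt_B W t = augment (completion W) (sigma_gen C0 {..t} (\<lambda>r \<omega>. \<omega> r))"

definition filt_mu0 :: "real \<Rightarrow> (real \<rightharpoonup> real^'m) measure" where
  "filt_mu0 s = sigma_gen point_functions {(q, r, D). q \<le> r \<and> r \<le> s \<and> D \<in> sets borel_nz}
                  (\<lambda>(q, r, D) p. point_count p ({q<..r} \<times> D))"

definition filt_mu :: "(real \<rightharpoonup> real^'m) measure \<Rightarrow> real \<Rightarrow> (real \<rightharpoonup> real^'m) measure" where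
  "filt_mu Q t = augment (completion Q) (sigma point_functions (\<Inter>s\<in>{t<..}. sets (filt_mu0 s)))"

definition filt_wp ::
  "(real \<Rightarrow> real^'d) measure \<Rightarrow> (real \<rightharpoonup> real^'m) measure \<Rightarrow> real \<Rightarrow>
   ((real \<Rightarrow> real^'d) \<times> (real \<rightharpoonup> real^'m)) measure" where
  "filt_wp W Q t = augment (wp_space W Q) (filt_B W t \<Otimes>\<^sub>M filt_mu Q t)"

definition incr :: "(real \<Rightarrow> 'v::ab_group_add) \<Rightarrow> real \<Rightarrow> real \<Rightarrow> 'v" where
  "incr w s r = w r - w s"

definition exchanges_increments ::
  "real \<Rightarrow> nat \<Rightarrow> (real \<Rightarrow> real^'d) \<Rightarrow> (real \<Rightarrow> real^'d) \<Rightarrow> bool" where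
  "exchanges_increments t l w w' \<longleftrightarrow>
     (\<forall>r\<in>{t - real l..t}.
        incr w' (t - real l) r = incr w (t - 2 * real l) (r - real l) \<and>
        incr w' (t - 2 * real l) (r - real l) = incr w (t - real l) r) \<and>
     (\<forall>s r. s \<le> r \<and> {s<..r} \<inter> {t - 2 * real l<..t} = {} \<longrightarrow> incr w' s r = incr w s r) \<and>
     w' 0 = 0"

definition tau1 :: "real \<Rightarrow> nat \<Rightarrow> (real \<Rightarrow> real^'d) \<Rightarrow> (real \<Rightarrow> real^'d)" where
  "tau1 t l w = (THE w'. exchanges_increments t l w w')"

definition tau1_pre :: "real \<Rightarrow> nat \<Rightarrow> (real \<Rightarrow> real^'d) \<Rightarrow> (real \<Rightarrow> real^'d)" where
  "tau1_pre t l w r =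
     w (min r (t - 2 * real l))
     + incr w (t - real l) (max (t - real l) (min t (r + real l)))
     + incr w (t - 2 * real l) (max (t - 2 * real l) (min (t - real l) (r - real l)))
     + incr w t (max r t)"

lemma exchanges_increments_unique:
  assumes "exchanges_increments t l w w'" "exchanges_increments t l w w''"
  shows "w' = w''"
proof -
  define a where "a = t - real l"
  define b where "b = t - 2 * real l"
  define D where "D r = w' r - w'' r" for r
  have mid: "incr w' a r = incr w'' a r" "incr w' b (r - real l) = incr w'' b (r - real l)"
    if "r \<in> {a..t}" for r
    using assms that unfolding exchanges_increments_def a_def b_def by auto
  have out: "incr w' s r = incr w'' s r" if "s \<le> r" "r \<le> b \<or> t \<le> s" for s r
  proof -
    have "{s<..r} \<inter> {t - 2 * real l<..t} = {}" using that by (auto simp: b_def)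
    with assms \<open>s \<le> r\<close> have "incr w' s r = incr w s r" "incr w'' s r = incr w s r"
      unfolding exchanges_increments_def by blast+
    then show ?thesis by simp
  qed
  have D1: "D r = D a" if "a \<le> r" "r \<le> t" for r
    using mid(1)[of r] that by (simp add: D_def incr_def algebra_simps)
  have D2: "D r = D b" if "b \<le> r" "r \<le> a" for r
    using mid(2)[of "r + real l"] that by (simp add: D_def incr_def algebra_simps a_def b_def)
  have D3: "D r = D b" if "r \<le> b" for r
    using out[of r b] that by (simp add: D_def incr_def algebra_simps)
  have D4: "D r = D t" if "t \<le> r" for r
    using out[of t r] that by (simp add: D_def incr_def algebra_simps)
  have "b \<le> a" "a \<le> t" by (auto simp: a_def b_def)
  then have "D a = D b" "D t = D b" using D1[of t] D2[of a] by simp_all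
  have const: "D r = D b" for r
  proof -
    consider "r \<le> b" | "b \<le> r" "r \<le> a" | "a \<le> r" "r \<le> t" | "t \<le> r" by linarith
    then show ?thesis
    proof cases
      case 1 then show ?thesis by (rule D3)
    next
      case 2 then show ?thesis by (rule D2)
    next
      case 3 then show ?thesis using D1[of r] \<open>D a = D b\<close> by simp
    next
      case 4 then show ?thesis using D4[of r] \<open>D t = D b\<close> by simp
    qed
  qed
  have "D 0 = 0" using assms by (simp add: D_def exchanges_increments_def)
  then have "D r = 0" for r using const[of r] const[of 0] by simp
  then show ?thesis by (auto simp: D_def)
qed

lemma tau1_pre_cases:
  "r \<le> t - 2 * real l \<Longrightarrow> tau1_pre t l w r = w r"
  "t - 2 * real l \<le> r \<Longrightarrow> r \<le> t - real l \<Longrightarrow>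
     tau1_pre t l w r = w (t - 2 * real l) + incr w (t - real l) (r + real l)"
  "t - real l \<le> r \<Longrightarrow> r \<le> t \<Longrightarrow>
     tau1_pre t l w r = w t - w (t - real l) + w (r - real l)"
  "t \<le> r \<Longrightarrow> tau1_pre t l w r = w r"
proof -
  have l: "0 \<le> real l" by simp
  show "tau1_pre t l w r = w r" if "r \<le> t - 2 * real l"
  proof -
    have "min r (t - 2 * real l) = r"
      "max (t - real l) (min t (r + real l)) = t - real l"
      "max (t - 2 * real l) (min (t - real l) (r - real l)) = t - 2 * real l"
      "max r t = t" using that l by linarith+
    then show ?thesis by (simp only: tau1_pre_def incr_def) simp
  qed
  show "tau1_pre t l w r = w (t - 2 * real l) + incr w (t - real l) (r + real l)"
    if "t - 2 * real l \<le> r" "r \<le> t - real l"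
  proof -
    have "min r (t - 2 * real l) = t - 2 * real l"
      "max (t - real l) (min t (r + real l)) = r + real l"
      "max (t - 2 * real l) (min (t - real l) (r - real l)) = t - 2 * real l"
      "max r t = t" using that l by linarith+
    then show ?thesis by (simp only: tau1_pre_def incr_def) simp
  qed
  show "tau1_pre t l w r = w t - w (t - real l) + w (r - real l)"
    if "t - real l \<le> r" "r \<le> t"
  proof -
    have "min r (t - 2 * real l) = t - 2 * real l"
      "max (t - real l) (min t (r + real l)) = t"
      "max (t - 2 * real l) (min (t - real l) (r - real l)) = r - real l"
      "max r t = t" using that l by linarith+
    then show ?thesis by (simp only: tau1_pre_def incr_def) simp
  qed
  show "tau1_pre t l w r = w r" if "t \<le> r"
  proof -
    have "min r (t - 2 * real l) = t - 2 * real l"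
      "max (t - real l) (min t (r + real l)) = t"
      "max (t - 2 * real l) (min (t - real l) (r - real l)) = t - real l"
      "max r t = r" using that l by linarith+
    then show ?thesis by (simp only: tau1_pre_def incr_def) simp
  qed
qed

lemma exchanges_increments_explicit:
  "exchanges_increments t l w (\<lambda>r. tau1_pre t l w r - tau1_pre t l w 0)"
proof -
  have out: "tau1_pre t l w r - tau1_pre t l w s = w r - w s"
    if sr: "s \<le> r" and dis: "{s<..r} \<inter> {t - 2 * real l<..t} = {}" for s r
  proof -
    have "min r t \<notin> {s<..r} \<inter> {t - 2 * real l<..t}" using dis by blast
    then consider "s = r" | "r \<le> t - 2 * real l" | "t \<le> s" | "l = 0"
      using sr by (force simp: min_def split: if_splits)
    then show ?thesis
    proof cases
      case 4
      then have "tau1_pre t l w x = w x" for x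
        using tau1_pre_cases(1)[of x t l w] tau1_pre_cases(4)[of t x l w] by (cases "x \<le> t") auto
      then show ?thesis by simp
    qed (use sr in \<open>simp_all add: tau1_pre_cases(1,4)\<close>)
  qed
  have a: "tau1_pre t l w (t - real l) = w t - w (t - real l) + w (t - 2 * real l)"
    using tau1_pre_cases(3)[of t l "t - real l" w] by simp
  have b: "tau1_pre t l w (t - 2 * real l) = w (t - 2 * real l)"
    by (rule tau1_pre_cases(1)) simp
  have mid1: "tau1_pre t l w r = w t - w (t - real l) + w (r - real l)"
    and mid2: "tau1_pre t l w (r - real l) = w (t - 2 * real l) + (w r - w (t - real l))"
    if "r \<in> {t - real l..t}" for r
    using that tau1_pre_cases(3)[of t l r w] tau1_pre_cases(2)[of t l "r - real l" w]
    by (simp_all add: incr_def)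
  show ?thesis
    unfolding exchanges_increments_def incr_def
    by (intro conjI ballI allI impI) (simp_all add: a b mid1 mid2 out)
qed

lemma tau1_eq: "tau1 t l w = (\<lambda>r. tau1_pre t l w r - tau1_pre t l w 0)"
  unfolding tau1_def
  by (rule the_equality)
    (rule exchanges_increments_explicit, erule exchanges_increments_unique[OF _ exchanges_increments_explicit])

lemma tau1_C0:
  assumes "w \<in> C0"
  shows "tau1 t l w \<in> C0"
proof -
  have c: "continuous_on UNIV (\<lambda>r. w (f r))" if "continuous_on UNIV f" for f :: "real \<Rightarrow> real"
    using assms continuous_on_compose2[of UNIV w UNIV f] that by (simp add: C0_def)
  have "continuous_on UNIV (\<lambda>r. tau1_pre t l w r - tau1_pre t l w 0)"
    unfolding tau1_pre_def incr_def by (intro continuous_intros c)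
  then show ?thesis by (simp add: C0_def tau1_eq)
qed

definition swap_time :: "real \<Rightarrow> nat \<Rightarrow> real \<Rightarrow> real" where
  "swap_time t l r =
     (if t - real l < r \<and> r \<le> t then r - real l
      else if t - 2 * real l < r \<and> r \<le> t - real l then r + real l
      else r)"

text \<open>Since \<^const>\<open>swap_time\<close> is an involution, moving every point of \<open>p\<close> from its time \<open>r\<close> to
  \<open>swap_time t l r\<close> is precomposition with \<^const>\<open>swap_time\<close>; see \<open>graph_tau2\<close>.\<close>

definition tau2 :: "real \<Rightarrow> nat \<Rightarrow> (real \<rightharpoonup> real^'m) \<Rightarrow> (real \<rightharpoonup> real^'m)" where
  "tau2 t l p = (\<lambda>r. p (swap_time t l r))"

lemma swap_time_swap_time [simp]: "swap_time t l (swap_time t l r) = r"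
  by (auto simp: swap_time_def)

lemma graph_tau2: "Map.graph (tau2 t l p) = (\<lambda>(r, e). (swap_time t l r, e)) ` Map.graph p"
  by (force simp: Map.graph_def tau2_def image_iff)

lemma tau2_point_functions:
  assumes "p \<in> point_functions"
  shows "tau2 t l p \<in> point_functions"
proof -
  have "dom (tau2 t l p) \<subseteq> swap_time t l ` dom p"
    by (force simp: tau2_def image_iff dom_def)
  then have "countable (dom (tau2 t l p))"
    using assms by (auto simp: point_functions_def intro: countable_subset[OF _ countable_image])
  moreover have "ran (tau2 t l p) \<subseteq> ran p" by (auto simp: tau2_def ran_def)
  ultimately show ?thesis using assms by (auto simp: point_functions_def)
qed

definition tau ::
  "real \<Rightarrow> nat \<Rightarrow> (real \<Rightarrow> real^'d) \<times> (real \<rightharpoonup> real^'m) \<Rightarrow> (real \<Rightarrow> real^'d) \<times> (real \<rightharpoonup> real^'m)" where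
  "tau t l = map_prod (tau1 t l) (tau2 t l)"

end

theory Submission
  imports Defs
begin

text \<open>
  Each event \<open>Z = {\<zeta> > c}\<close> is invariant under all exchanges \<open>tau t l\<close>
  and measurable with respect to what is observed up to time \<open>t\<close>, up to null sets and with an
  arbitrarily short look beyond \<open>t\<close> at the points. The point is that the exchanges are mixing for
  such events, so that \<open>Z\<close> is independent of itself.

  Let \<open>s > t\<close>. Suppose that \<open>E\<close> depends on finitely many increments of the path
  before \<open>t\<close> and finitely many counts of points before \<open>s\<close>, and \<open>F\<close> on
  finitely many increments before \<open>t\<close> and finitely many counts of points outside the time
  interval \<open>(t, s]\<close>. If \<open>l\<close> is large, then \<open>tau t l\<close> carries the
  part of \<open>E\<close> before \<open>t\<close> into \<open>(t - 2 l, t - l]\<close>, where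
  \<open>F\<close> sees nothing, and leaves the part in \<open>(t, s]\<close> alone, where \<open>F\<close>
  sees nothing either. Independence over disjoint time sets and invariance of the measure give
  \<open>P(tau\<^sup>-\<^sup>1 E \<inter> F) = P(E) P(F)\<close>. A Dynkin argument extends this, as a
  limit for \<open>l \<longlongrightarrow> \<infinity>\<close>, to all \<open>E\<close> observable up to
  \<open>t\<close> and \<open>s\<close> and all \<open>F\<close> outside the gap (\<open>mixing_WQ\<close>).
  For the invariant event \<open>E = Z\<close> there is no limit left:
  \<open>P(Z \<inter> F) = P(Z) P(F)\<close>. As \<open>s\<close> decreases to \<open>t\<close>, the
  events \<open>F\<close> generate a \<open>\<sigma>\<close>-algebra that contains \<open>Z\<close>
  (\<open>past_N_right_N\<close>), so \<open>P(Z) = P(Z)\<^sup>2\<close>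
  (\<open>modification_trivial\<close>). The gap deals with the right-continuity of the Poisson filtration at
  the same stroke.

  Path and points are treated by one theorem on random fields with independent values over disjoint cells
  whose laws depend only on the size of the cell (locale \<open>scattered_field\<close>, theorem
  \<open>mixing\<close>). The Wiener space needs two additions: increments across time \<open>0\<close> have
  to be pieced together from the two independent halves (\<open>wiener_indep\<close>,
  \<open>wiener_law\<close>), and the Borel \<open>\<sigma>\<close>-algebra of uniform convergence on compacts
  has to be identified with the one generated by the increments (\<open>sets_wiener\<close>).
\<close>

section \<open>Setwise limits, joint laws and cylinder events\<close>

text \<open>
  The events \<open>E\<close> with
  \<open>P(S\<^sub>k\<^sup>-\<^sup>1 E \<inter> C\<^sub>k) \<longlongrightarrow> P(E) c\<close> form a
  Dynkin system, so it is enough to know the limit on an intersection-stable generator. Letting both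
  \<open>S\<^sub>k\<close> and \<open>C\<^sub>k\<close> vary covers three situations: mixing with a fixed
  second event (\<open>C\<^sub>k = F\<close>), mixing with a fixed first event
  (\<open>S\<^sub>k = id\<close> and \<open>C\<^sub>k\<close> its preimage), and independence of a fixed
  event (everything constant).
\<close>

lemma (in prob_space) setwise_limit_extends:
  fixes S :: "nat \<Rightarrow> 'a \<Rightarrow> 'a" and C :: "nat \<Rightarrow> 'a set"
  assumes G: "Int_stable G" "G \<subseteq> events"
    and space: "\<And>k x. x \<in> space M \<Longrightarrow> S k x \<in> space M"
    and meas: "\<And>k E. E \<in> sigma_sets (space M) G \<Longrightarrow> S k -` E \<inter> space M \<in> events"
    and pres: "\<And>k E. E \<in> sigma_sets (space M) G \<Longrightarrow> prob (S k -` E \<inter> space M) = prob E"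
    and C: "\<And>k. C k \<in> events" "(\<lambda>k. prob (C k)) \<longlonglongrightarrow> c"
    and lim: "\<And>E. E \<in> G \<Longrightarrow> (\<lambda>k. prob (S k -` E \<inter> C k)) \<longlonglongrightarrow> prob E * c"
    and E: "E \<in> sigma_sets (space M) G"
  shows "(\<lambda>k. prob (S k -` E \<inter> C k)) \<longlonglongrightarrow> prob E * c"
proof -
  have GP: "G \<subseteq> Pow (space M)" using G(2) sets.space_closed by blast
  have Gev: "A \<in> events" if "A \<in> sigma_sets (space M) G" for A
    using sets.sigma_sets_subset[OF G(2)] that by auto
  have Csub: "C k \<subseteq> space M" for k using C(1) sets.sets_into_space by blast
  have rw: "S k -` A \<inter> C k = (S k -` A \<inter> space M) \<inter> C k" for k A using Csub by blast
  have ev: "S k -` A \<inter> C k \<in> events" if "A \<in> sigma_sets (space M) G" for k A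
    unfolding rw using meas[OF that] C(1) by auto
  show ?thesis using G(1) GP E
  proof (induction rule: sigma_sets_induct_disjoint)
    case (basic A) then show ?case by (rule lim)
  next
    case empty then show ?case by simp
  next
    case (compl A)
    have "prob (S k -` (space M - A) \<inter> C k) = prob (C k) - prob (S k -` A \<inter> C k)" for k
    proof -
      have "S k -` (space M - A) \<inter> C k = C k - (S k -` A \<inter> C k)"
        using Csub[of k] space[of _ k] by auto
      then show ?thesis using finite_measure_Diff[OF C(1) ev[OF compl(1)]] by simp
    qed
    moreover have "(\<lambda>k. prob (C k) - prob (S k -` A \<inter> C k)) \<longlonglongrightarrow> c - prob A * c"
      by (intro tendsto_diff C compl)
    moreover have "c - prob A * c = prob (space M - A) * c"
      by (simp add: prob_compl[OF Gev[OF compl(1)]] algebra_simps)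
    ultimately show ?case by simp
  next
    case (union A)
    have A: "A i \<in> sigma_sets (space M) G" for i using union by auto
    have "summable (\<lambda>i. prob (A i))" and sumA: "(\<lambda>i. prob (A i)) sums prob (\<Union>i. A i)"
      using finite_measure_UNION[of A] Gev[OF A] union(1) by (auto simp: sums_iff)
    have s: "prob (S k -` (\<Union>i. A i) \<inter> C k) = (\<Sum>i. prob (S k -` A i \<inter> C k))" for k
    proof -
      have "disjoint_family (\<lambda>i. S k -` A i \<inter> C k)"
        using union(1) by (auto simp: disjoint_family_on_def)
      then have "(\<lambda>i. prob (S k -` A i \<inter> C k)) sums prob (\<Union>i. S k -` A i \<inter> C k)"
        using ev[OF A] by (intro finite_measure_UNION) auto
      moreover have "(\<Union>i. S k -` A i \<inter> C k) = S k -` (\<Union>i. A i) \<inter> C k" by auto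
      ultimately show ?thesis by (simp add: sums_iff)
    qed
    \<comment> \<open>Preservation of measure makes the tails of the series small uniformly in \<open>k\<close>.\<close>
    have dom: "prob (S k -` A i \<inter> C k) \<le> prob (A i)" for i k
    proof -
      have "prob (S k -` A i \<inter> C k) \<le> prob (S k -` A i \<inter> space M)"
        by (rule finite_measure_mono) (use Csub meas[OF A] in auto)
      then show ?thesis by (simp add: pres[OF A])
    qed
    have "(\<lambda>k. \<Sum>i. prob (S k -` A i \<inter> C k)) \<longlonglongrightarrow> (\<Sum>i. prob (A i) * c)"
    proof (rule tannerys_theorem[THEN conjunct2, THEN conjunct2, OF _ _ \<open>summable (\<lambda>i. prob (A i))\<close>])
      show "\<forall>\<^sub>F (i, k) in at_top \<times>\<^sub>F sequentially. norm (prob (S k -` A i \<inter> C k)) \<le> prob (A i)"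
        by (rule always_eventually) (simp add: dom)
    qed (use union in auto)
    moreover have "(\<Sum>i. prob (A i) * c) = prob (\<Union>i. A i) * c"
      using sums_mult2[OF sumA, of c] by (simp add: sums_iff)
    ultimately show ?case using s by simp
  qed
qed

lemma (in prob_space) mixing_extends:
  assumes G: "Int_stable G" "G \<subseteq> events" and H: "Int_stable H" "H \<subseteq> events"
    and space: "\<And>k x. x \<in> space M \<Longrightarrow> S k x \<in> space M"
    and meas: "\<And>k E. E \<in> sigma_sets (space M) G \<Longrightarrow> S k -` E \<inter> space M \<in> events"
    and pres: "\<And>k E. E \<in> sigma_sets (space M) G \<Longrightarrow> prob (S k -` E \<inter> space M) = prob E"
    and lim: "\<And>E F. E \<in> G \<Longrightarrow> F \<in> H \<Longrightarrow> (\<lambda>k. prob (S k -` E \<inter> F)) \<longlonglongrightarrow> prob E * prob F"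
    and E: "E \<in> sigma_sets (space M) G" and F: "F \<in> sigma_sets (space M) H"
  shows "(\<lambda>k. prob (S k -` E \<inter> F)) \<longlonglongrightarrow> prob E * prob F"
proof -
  have Hev: "A \<in> events" if "A \<in> sigma_sets (space M) H" for A
    using sets.sigma_sets_subset[OF H(2)] that by auto
  have first: "(\<lambda>k. prob (S k -` E \<inter> F)) \<longlonglongrightarrow> prob E * prob F" if "F \<in> H" for F
    by (rule setwise_limit_extends[OF G space meas pres _ _ _ E]) (use that H lim in auto)
  have swap: "(\<lambda>x. x) -` F \<inter> (S k -` E \<inter> space M) = S k -` E \<inter> F" if "F \<in> events" for F k
    using sets.sets_into_space[OF that] by auto
  have "(\<lambda>k. prob ((\<lambda>x. x) -` F \<inter> (S k -` E \<inter> space M))) \<longlonglongrightarrow> prob F * prob E"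
  proof (rule setwise_limit_extends[OF H _ _ _ _ _ _ F])
    show "(\<lambda>k. prob ((\<lambda>x. x) -` F \<inter> (S k -` E \<inter> space M))) \<longlonglongrightarrow> prob F * prob E" if "F \<in> H" for F
      using first[OF that] swap[of F] H(2) that by (auto simp: mult.commute)
  qed (use meas[OF E] pres[OF E] Hev sets.sets_into_space in \<open>auto simp: Int_absorb2\<close>)
  then show ?thesis unfolding swap[OF Hev[OF F]] by (simp add: mult.commute)
qed

lemma (in prob_space) indep_vars_reindex_inj:
  assumes f: "inj_on f J" and ind: "indep_vars N X (f ` J)"
  shows "indep_vars (\<lambda>j. N (f j)) (\<lambda>j. X (f j)) J"
proof -
  have *: "indep_sets F (f ` J) \<Longrightarrow> indep_sets (\<lambda>j. F (f j)) J" for F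
  proof -
    assume F: "indep_sets F (f ` J)"
    show ?thesis unfolding indep_sets_def
    proof (intro conjI ballI allI impI)
      fix j assume "j \<in> J" then show "F (f j) \<subseteq> events" using F by (auto simp: indep_sets_def)
    next
      fix K A assume K: "K \<subseteq> J" "K \<noteq> {}" "finite K" and A: "A \<in> Pi K (\<lambda>j. F (f j))"
      have inj: "inj_on f K" using f K(1) by (rule inj_on_subset)
      define A' where "A' i = A (inv_into K f i)" for i
      have A': "A' (f j) = A j" if "j \<in> K" for j using that inj by (simp add: A'_def)
      have "prob (\<Inter>i\<in>f ` K. A' i) = (\<Prod>i\<in>f ` K. prob (A' i))"
        using F K A A' by (intro indep_setsD[OF F]) auto
      moreover have "(\<Inter>i\<in>f ` K. A' i) = (\<Inter>j\<in>K. A j)" using A' by auto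
      moreover have "(\<Prod>i\<in>f ` K. prob (A' i)) = (\<Prod>j\<in>K. prob (A j))"
        using A' by (simp add: prod.reindex[OF inj])
      ultimately show "prob (\<Inter>j\<in>K. A j) = (\<Prod>j\<in>K. prob (A j))" by simp
    qed
  qed
  then show ?thesis using ind unfolding indep_vars_def2 by auto
qed

text \<open>
  A finite independent family has the product of its marginals as joint law. This reduces every comparison of
  joint laws below to one of marginals.
\<close>

lemma (in prob_space) indep_vars_same_joint_law:
  assumes "indep_vars N X I" "indep_vars N Y I"
    and eq: "\<And>i. i \<in> I \<Longrightarrow> distr M (N i) (X i) = distr M (N i) (Y i)"
  shows "distr M (PiM I N) (\<lambda>\<omega>. \<lambda>i\<in>I. X i \<omega>) = distr M (PiM I N) (\<lambda>\<omega>. \<lambda>i\<in>I. Y i \<omega>)"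
proof (cases "I = {}")
  case False
  then show ?thesis
    using assms(1,2) indep_vars_iff_distr_eq_PiM'[OF False, where M'=N and X=X]
      indep_vars_iff_distr_eq_PiM'[OF False, where M'=N and X=Y]
    by (simp add: indep_vars_def2 eq cong: PiM_cong)
qed (simp add: restrict_def)

text \<open>
  Events that depend on finitely many of the \<open>X i\<close>, in an arbitrary measurable way. They form an
  intersection-stable generator of \<open>sigma_gen \<Omega> I X\<close> to which finite-dimensional laws
  apply directly.
\<close>

definition cylinders :: "'a set \<Rightarrow> 'i set \<Rightarrow> ('i \<Rightarrow> 'a \<Rightarrow> 'b::topological_space) \<Rightarrow> 'a set set" where
  "cylinders \<Omega> I X =
     {{\<omega> \<in> \<Omega>. (\<lambda>i\<in>J. X i \<omega>) \<in> B} | J B. finite J \<and> J \<subseteq> I \<and> B \<in> sets (PiM J (\<lambda>_. borel))}"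

lemma cylinders_Pow: "cylinders \<Omega> I X \<subseteq> Pow \<Omega>"
  by (auto simp: cylinders_def)

lemma Int_stable_cylinders: "Int_stable (cylinders \<Omega> I X)"
proof (rule Int_stableI)
  fix A B assume "A \<in> cylinders \<Omega> I X" "B \<in> cylinders \<Omega> I X"
  then obtain J K A' B' where J: "finite J" "J \<subseteq> I" "A' \<in> sets (PiM J (\<lambda>_. borel))" and A: "A = {\<omega> \<in> \<Omega>. (\<lambda>i\<in>J. X i \<omega>) \<in> A'}"
    and K: "finite K" "K \<subseteq> I" "B' \<in> sets (PiM K (\<lambda>_. borel))" and B: "B = {\<omega> \<in> \<Omega>. (\<lambda>i\<in>K. X i \<omega>) \<in> B'}"
    by (auto simp: cylinders_def)
  let ?P = "PiM (J \<union> K) (\<lambda>_. borel) :: (_ \<Rightarrow> 'c) measure"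
  define D where "D = ((\<lambda>y. restrict y J) -` A' \<inter> space ?P) \<inter> ((\<lambda>y. restrict y K) -` B' \<inter> space ?P)"
  have "D \<in> sets ?P" unfolding D_def
    by (intro sets.Int measurable_sets[OF measurable_restrict_subset J(3)] measurable_sets[OF measurable_restrict_subset K(3)]) auto
  moreover have "A \<inter> B = {\<omega> \<in> \<Omega>. (\<lambda>i\<in>J \<union> K. X i \<omega>) \<in> D}"
    by (auto simp: A B D_def space_PiM PiE_def Int_absorb1)
  ultimately show "A \<inter> B \<in> cylinders \<Omega> I X"
    using J K unfolding cylinders_def by (intro CollectI exI[of _ "J \<union> K"] exI[of _ D]) auto
qed

lemma sigma_gen_preimage_sets: "(\<Union>i\<in>I. {X i -` A \<inter> \<Omega> | A. A \<in> sets borel}) \<subseteq> Pow \<Omega>"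
  by auto

lemma space_sigma_gen [simp]: "space (sigma_gen \<Omega> I X) = \<Omega>"
  by (simp add: sigma_gen_def sigma_gen_preimage_sets)

lemma measurable_sigma_gen: "i \<in> I \<Longrightarrow> X i \<in> borel_measurable (sigma_gen \<Omega> I X)"
  by (rule measurableI) (auto simp: sigma_gen_def sigma_gen_preimage_sets)

lemma sets_sigma_gen_subset:
  assumes "space M = \<Omega>" "\<And>i. i \<in> I \<Longrightarrow> X i \<in> borel_measurable M"
  shows "sets (sigma_gen \<Omega> I X) \<subseteq> sets M"
  unfolding sigma_gen_def sets_measure_of[OF sigma_gen_preimage_sets]
proof -
  have "sigma_sets (space M) (\<Union>i\<in>I. {X i -` A \<inter> \<Omega> | A. A \<in> sets borel}) \<subseteq> sets M"
    using assms by (intro sets.sigma_sets_subset) (auto dest: measurable_sets)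
  then show "sigma_sets \<Omega> (\<Union>i\<in>I. {X i -` A \<inter> \<Omega> | A. A \<in> sets borel}) \<subseteq> sets M"
    by (simp add: assms(1))
qed

lemma sets_sigma_gen_cylinders: "sets (sigma_gen \<Omega> I X) = sigma_sets \<Omega> (cylinders \<Omega> I X)"
proof
  have "X i \<in> borel_measurable (sigma \<Omega> (cylinders \<Omega> I X))" if "i \<in> I" for i
  proof (rule measurableI)
    fix A :: "'c set" assume A: "A \<in> sets borel"
    have "X i -` A \<inter> \<Omega> = {\<omega> \<in> \<Omega>. (\<lambda>j\<in>{i}. X j \<omega>) \<in> (\<lambda>y. y i) -` A \<inter> space (PiM {i} (\<lambda>_. borel))}"
      by (auto simp: space_PiM)
    moreover have "(\<lambda>y. y i) -` A \<inter> space (PiM {i} (\<lambda>_. borel)) \<in> sets (PiM {i} (\<lambda>_. borel))"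
      by (rule measurable_sets[OF _ A]) simp
    ultimately have "X i -` A \<inter> \<Omega> \<in> cylinders \<Omega> I X"
      using that unfolding cylinders_def by blast
    then show "X i -` A \<inter> space (sigma \<Omega> (cylinders \<Omega> I X)) \<in> sets (sigma \<Omega> (cylinders \<Omega> I X))"
      by (simp add: cylinders_Pow)
  qed auto
  then show "sets (sigma_gen \<Omega> I X) \<subseteq> sigma_sets \<Omega> (cylinders \<Omega> I X)"
    using sets_sigma_gen_subset[of "sigma \<Omega> (cylinders \<Omega> I X)" \<Omega> I X] by (simp add: cylinders_Pow)
  have "cylinders \<Omega> I X \<subseteq> sets (sigma_gen \<Omega> I X)"
  proof
    fix E assume "E \<in> cylinders \<Omega> I X"
    then obtain J B where J: "finite J" "J \<subseteq> I" and B: "B \<in> sets (PiM J (\<lambda>_. borel))" and E: "E = {\<omega> \<in> \<Omega>. (\<lambda>i\<in>J. X i \<omega>) \<in> B}"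
      by (auto simp: cylinders_def)
    have "(\<lambda>\<omega>. \<lambda>i\<in>J. X i \<omega>) \<in> sigma_gen \<Omega> I X \<rightarrow>\<^sub>M PiM J (\<lambda>_. borel)"
      by (intro measurable_restrict measurable_sigma_gen) (use J in auto)
    from measurable_sets[OF this B] show "E \<in> sets (sigma_gen \<Omega> I X)"
      by (simp add: E vimage_def Int_def conj_commute)
  qed
  from sets.sigma_sets_subset[OF this] show "sigma_sets \<Omega> (cylinders \<Omega> I X) \<subseteq> sets (sigma_gen \<Omega> I X)"
    by simp
qed

section \<open>Random fields with independent values on disjoint cells\<close>

text \<open>
  A random field \<open>X\<close> over a class \<open>\<C>\<close> of cells, which are sets of points of type
  \<open>'x\<close>: masses of disjoint cells are independent, and the law of \<open>X A\<close> depends on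
  the size \<open>\<nu> A\<close> only. The increments of a Brownian motion over half-open intervals and the
  counts of a Poisson random measure are of this kind.

  On \<open>'x\<close> acts a sequence of size-preserving maps \<open>\<phi> k\<close>, which
  \<open>T k\<close> lifts to sample points. The cells in \<open>\<C>' k\<close> are those on which this
  lift acts as expected; the exchange of two time intervals tears an interval that straddles one of its break
  points, so \<open>\<C>' k\<close> has to be allowed to be smaller than \<open>\<C>\<close>. Every finite
  set of cells can be cut into finitely many disjoint nonempty cells of \<open>\<C>' k\<close>; this also
  expresses the additivity of \<open>X\<close>.
\<close>

locale scattered_field = prob_space M
  for M :: "'a measure" +
  fixes \<C> :: "'x set set"
    and X :: "'x set \<Rightarrow> 'a \<Rightarrow> 'v::{second_countable_topology, topological_comm_monoid_add}"
    and \<nu> :: "'x set \<Rightarrow> 'n"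
    and \<phi> :: "nat \<Rightarrow> 'x \<Rightarrow> 'x" and T :: "nat \<Rightarrow> 'a \<Rightarrow> 'a" and \<C>' :: "nat \<Rightarrow> 'x set set"
  assumes rv: "A \<in> \<C> \<Longrightarrow> X A \<in> borel_measurable M"
    and indep: "finite P \<Longrightarrow> P \<subseteq> \<C> \<Longrightarrow> disjoint P \<Longrightarrow> indep_vars (\<lambda>_. borel) X P"
    and law: "A \<in> \<C> \<Longrightarrow> B \<in> \<C> \<Longrightarrow> \<nu> A = \<nu> B \<Longrightarrow> distr M borel (X A) = distr M borel (X B)"
    and \<C>'_subset: "\<C>' k \<subseteq> \<C>"
    and surj: "surj (\<phi> k)"
    and vimage: "A \<in> \<C>' k \<Longrightarrow> \<phi> k -` A \<in> \<C>"
    and pres: "A \<in> \<C>' k \<Longrightarrow> \<nu> (\<phi> k -` A) = \<nu> A"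
    and transport: "A \<in> \<C>' k \<Longrightarrow> X A (T k \<omega>) = X (\<phi> k -` A) \<omega>"
    and T_space: "\<omega> \<in> space M \<Longrightarrow> T k \<omega> \<in> space M"
    and refine: "finite D \<Longrightarrow> D \<subseteq> \<C> \<Longrightarrow>
      \<exists>P. finite P \<and> disjoint P \<and> {} \<notin> P \<and> P \<subseteq> \<C>' k \<and> (\<forall>A\<in>D. \<forall>\<omega>. X A \<omega> = (\<Sum>Q\<in>{Q\<in>P. Q \<subseteq> A}. X Q \<omega>))"
begin

text \<open>
  Cut all cells of \<open>D1 \<union> D2\<close> into disjoint pieces. Pieces are nonempty, so none lies
  both below a cell of \<open>D1\<close> and below a cell of \<open>D2\<close>: the two vectors are functions
  of disjoint groups of an independent family.
\<close>

lemma indep_disjoint_supports: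
  assumes D: "finite D1" "D1 \<subseteq> \<C>" "finite D2" "D2 \<subseteq> \<C>"
    and disj: "\<And>A B. A \<in> D1 \<Longrightarrow> B \<in> D2 \<Longrightarrow> A \<inter> B = {}"
  shows "indep_var (PiM D1 (\<lambda>_. borel)) (\<lambda>\<omega>. \<lambda>A\<in>D1. X A \<omega>) (PiM D2 (\<lambda>_. borel)) (\<lambda>\<omega>. \<lambda>A\<in>D2. X A \<omega>)"
proof -
  obtain P where P: "finite P" "disjoint P" "{} \<notin> P" "P \<subseteq> \<C>' 0"
    and XP: "\<And>A \<omega>. A \<in> D1 \<union> D2 \<Longrightarrow> X A \<omega> = (\<Sum>Q\<in>{Q\<in>P. Q \<subseteq> A}. X Q \<omega>)"
    using refine[of "D1 \<union> D2" 0] D by auto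
  define U where "U D = {Q\<in>P. \<exists>A\<in>D. Q \<subseteq> A}" for D
  define S where "S D y = (\<lambda>A\<in>D. \<Sum>Q\<in>{Q\<in>P. Q \<subseteq> A}. y Q)" for D :: "'x set set" and y :: "'x set \<Rightarrow> 'v"
  have "indep_vars (\<lambda>_. borel) X P" using P \<C>'_subset by (intro indep) auto
  moreover have "U D1 \<inter> U D2 = {}"
  proof -
    have False if Q: "Q \<in> P" "A \<in> D1" "Q \<subseteq> A" "B \<in> D2" "Q \<subseteq> B" for Q A B
      using Q disj[OF Q(2,4)] P(3) by (metis inf.bounded_iff subset_empty)
    then show ?thesis by (auto simp: U_def)
  qed
  ultimately have U: "indep_var (PiM (U D1) (\<lambda>_. borel)) (\<lambda>\<omega>. \<lambda>A\<in>U D1. X A \<omega>) (PiM (U D2) (\<lambda>_. borel)) (\<lambda>\<omega>. \<lambda>A\<in>U D2. X A \<omega>)"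
    by (rule indep_var_restrict) (auto simp: U_def)
  have S: "S D \<in> PiM (U D) (\<lambda>_. borel) \<rightarrow>\<^sub>M PiM D (\<lambda>_. borel)" for D
    unfolding S_def
    by (intro measurable_restrict borel_measurable_sum measurable_component_singleton) (auto simp: U_def)
  have "indep_var (PiM D1 (\<lambda>_. borel)) (S D1 \<circ> (\<lambda>\<omega>. \<lambda>A\<in>U D1. X A \<omega>))
      (PiM D2 (\<lambda>_. borel)) (S D2 \<circ> (\<lambda>\<omega>. \<lambda>A\<in>U D2. X A \<omega>))"
    by (rule indep_var_compose[OF U S S])
  moreover have "S D \<circ> (\<lambda>\<omega>. \<lambda>A\<in>U D. X A \<omega>) = (\<lambda>\<omega>. \<lambda>A\<in>D. X A \<omega>)" if "D \<subseteq> D1 \<union> D2" for D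
  proof -
    have "(\<Sum>Q\<in>{Q\<in>P. Q \<subseteq> A}. if Q \<in> U D then X Q \<omega> else undefined) = X A \<omega>" if "A \<in> D" for A \<omega>
      using that \<open>D \<subseteq> D1 \<union> D2\<close> by (subst XP) (auto simp: U_def intro!: sum.cong)
    then show ?thesis
      by (auto simp: S_def fun_eq_iff restrict_def)
  qed
  ultimately show ?thesis by simp
qed

lemma transported_rv:
  assumes A: "A \<in> \<C>"
  shows "(\<lambda>\<omega>. X A (T k \<omega>)) \<in> borel_measurable M"
proof -
  obtain P where P: "P \<subseteq> \<C>' k" and XP: "\<And>\<omega>. X A \<omega> = (\<Sum>Q\<in>{Q\<in>P. Q \<subseteq> A}. X Q \<omega>)"
    using refine[of "{A}" k] A by auto
  have "(\<lambda>\<omega>. \<Sum>Q\<in>{Q\<in>P. Q \<subseteq> A}. X (\<phi> k -` Q) \<omega>) \<in> borel_measurable M"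
    using P by (intro borel_measurable_sum rv vimage) auto
  also have "(\<lambda>\<omega>. \<Sum>Q\<in>{Q\<in>P. Q \<subseteq> A}. X (\<phi> k -` Q) \<omega>) = (\<lambda>\<omega>. X A (T k \<omega>))"
    using P by (auto simp: XP transport fun_eq_iff intro!: sum.cong)
  finally show "(\<lambda>\<omega>. X A (T k \<omega>)) \<in> borel_measurable M" .
qed

text \<open>
  Over the pieces \<open>Q\<close> of a common refinement,
  \<open>X Q \<circ> T k = X (\<phi> k -` Q)\<close> is again an independent family, with the same
  marginals because \<open>\<phi> k\<close> preserves \<open>\<nu>\<close>. The masses of the cells in
  \<open>D\<close> are the same sums in either family.
\<close>

lemma transported_law:
  assumes D: "finite D" "D \<subseteq> \<C>"
  shows "distr M (PiM D (\<lambda>_. borel)) (\<lambda>\<omega>. \<lambda>A\<in>D. X A (T k \<omega>)) = distr M (PiM D (\<lambda>_. borel)) (\<lambda>\<omega>. \<lambda>A\<in>D. X A \<omega>)"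
proof -
  obtain P where P: "finite P" "disjoint P" "{} \<notin> P" "P \<subseteq> \<C>' k"
    and XP: "\<And>A \<omega>. A \<in> D \<Longrightarrow> X A \<omega> = (\<Sum>Q\<in>{Q\<in>P. Q \<subseteq> A}. X Q \<omega>)"
    using refine[OF D, of k] by auto
  define S where "S y = (\<lambda>A\<in>D. \<Sum>Q\<in>{Q\<in>P. Q \<subseteq> A}. y Q)" for y :: "'x set \<Rightarrow> 'v"
  have S: "S \<in> PiM P (\<lambda>_. borel) \<rightarrow>\<^sub>M PiM D (\<lambda>_. borel)"
    unfolding S_def
    by (intro measurable_restrict borel_measurable_sum measurable_component_singleton) auto
  have PC: "P \<subseteq> \<C>" using P(4) \<C>'_subset by blast
  have inj: "inj_on (\<lambda>Q. \<phi> k -` Q) P" by (rule inj_onI) (metis surj surj_image_vimage_eq)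
  have "disjoint ((\<lambda>Q. \<phi> k -` Q) ` P)"
    using P(2) inj by (auto simp: disjoint_def)
  then have "indep_vars (\<lambda>_. borel) X ((\<lambda>Q. \<phi> k -` Q) ` P)"
    using P vimage by (intro indep) auto
  from indep_vars_reindex_inj[OF inj this]
  have "distr M (PiM P (\<lambda>_. borel)) (\<lambda>\<omega>. \<lambda>Q\<in>P. X (\<phi> k -` Q) \<omega>) = distr M (PiM P (\<lambda>_. borel)) (\<lambda>\<omega>. \<lambda>Q\<in>P. X Q \<omega>)"
    using P PC by (intro indep_vars_same_joint_law indep law vimage pres) auto
  then have "distr (distr M (PiM P (\<lambda>_. borel)) (\<lambda>\<omega>. \<lambda>Q\<in>P. X (\<phi> k -` Q) \<omega>)) (PiM D (\<lambda>_. borel)) S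
      = distr (distr M (PiM P (\<lambda>_. borel)) (\<lambda>\<omega>. \<lambda>Q\<in>P. X Q \<omega>)) (PiM D (\<lambda>_. borel)) S"
    by simp
  moreover have "(\<lambda>\<omega>. \<lambda>Q\<in>P. X Q \<omega>) \<in> M \<rightarrow>\<^sub>M PiM P (\<lambda>_. borel)" "(\<lambda>\<omega>. \<lambda>Q\<in>P. X (\<phi> k -` Q) \<omega>) \<in> M \<rightarrow>\<^sub>M PiM P (\<lambda>_. borel)"
    using P PC by (auto intro!: measurable_restrict rv vimage)
  moreover have "S \<circ> (\<lambda>\<omega>. \<lambda>Q\<in>P. X Q \<omega>) = (\<lambda>\<omega>. \<lambda>A\<in>D. X A \<omega>)"
    by (auto simp: S_def fun_eq_iff restrict_def XP intro!: sum.cong)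
  moreover have "S \<circ> (\<lambda>\<omega>. \<lambda>Q\<in>P. X (\<phi> k -` Q) \<omega>) = (\<lambda>\<omega>. \<lambda>A\<in>D. X A (T k \<omega>))"
    using P(4) by (auto simp: S_def fun_eq_iff restrict_def XP transport intro!: sum.cong)
  ultimately show "distr M (PiM D (\<lambda>_. borel)) (\<lambda>\<omega>. \<lambda>A\<in>D. X A (T k \<omega>)) = distr M (PiM D (\<lambda>_. borel)) (\<lambda>\<omega>. \<lambda>A\<in>D. X A \<omega>)"
    using S by (simp add: distr_distr)
qed

abbreviation \<G> :: "'x set set \<Rightarrow> 'a measure" where
  "\<G> D \<equiv> sigma_gen (space M) D X"

lemma sets_\<G>: "D \<subseteq> \<C> \<Longrightarrow> sets (\<G> D) \<subseteq> events"
  using rv by (intro sets_sigma_gen_subset) auto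

lemma measurable_T: "T k \<in> M \<rightarrow>\<^sub>M \<G> \<C>"
  unfolding sigma_gen_def
proof (rule measurable_measure_of[OF sigma_gen_preimage_sets])
  show "T k -` B \<inter> space M \<in> events" if *: "B \<in> (\<Union>i\<in>\<C>. {X i -` A \<inter> space M |A. A \<in> sets borel})" for B
  proof -
    obtain A Y where A: "A \<in> \<C>" "Y \<in> sets borel" and B: "B = X A -` Y \<inter> space M"
      using * by blast
    have "T k -` B \<inter> space M = (\<lambda>\<omega>. X A (T k \<omega>)) -` Y \<inter> space M"
      using T_space by (auto simp: B)
    then show ?thesis using measurable_sets[OF transported_rv[OF A(1)] A(2)] by simp
  qed
qed (use T_space in auto)

lemma cylinder_transport:
  assumes "finite D" "D \<subseteq> \<C>" "B \<in> sets (PiM D (\<lambda>_. borel))"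
  shows "prob ((\<lambda>\<omega>. \<lambda>A\<in>D. X A (T k \<omega>)) -` B \<inter> space M) = prob ((\<lambda>\<omega>. \<lambda>A\<in>D. X A \<omega>) -` B \<inter> space M)"
proof -
  have "(\<lambda>\<omega>. \<lambda>A\<in>D. X A (T k \<omega>)) \<in> M \<rightarrow>\<^sub>M PiM D (\<lambda>_. borel)" "(\<lambda>\<omega>. \<lambda>A\<in>D. X A \<omega>) \<in> M \<rightarrow>\<^sub>M PiM D (\<lambda>_. borel)"
    using assms by (auto intro!: measurable_restrict rv transported_rv)
  from this[THEN measure_distr, OF assms(3)] transported_law[OF assms(1,2), of k] show ?thesis by simp
qed

lemma measure_preserving:
  assumes "E \<in> sets (\<G> \<C>)"
  shows "prob (T k -` E \<inter> space M) = prob E"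
proof -
  have id: "(\<lambda>x. x) \<in> M \<rightarrow>\<^sub>M \<G> \<C>" using sets_\<G>[of \<C>] by (auto intro!: measurableI)
  have "distr M (\<G> \<C>) (T k) = distr M (\<G> \<C>) (\<lambda>x. x)"
  proof (rule measure_eqI_generator_eq[OF Int_stable_cylinders[of "space M" \<C> X] cylinders_Pow, where A="\<lambda>_. space M"])
    fix C assume "C \<in> cylinders (space M) \<C> X"
    then obtain D B where D: "finite D" "D \<subseteq> \<C>" "B \<in> sets (PiM D (\<lambda>_. borel))"
      and C: "C = {\<omega> \<in> space M. (\<lambda>A\<in>D. X A \<omega>) \<in> B}" by (auto simp: cylinders_def)
    have "C \<in> sets (\<G> \<C>)" unfolding sets_sigma_gen_cylinders using \<open>C \<in> _\<close> by (rule sigma_sets.Basic)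
    moreover have "T k -` C \<inter> space M = (\<lambda>\<omega>. \<lambda>A\<in>D. X A (T k \<omega>)) -` B \<inter> space M"
      "C \<inter> space M = (\<lambda>\<omega>. \<lambda>A\<in>D. X A \<omega>) -` B \<inter> space M"
      using T_space by (auto simp: C)
    ultimately show "emeasure (distr M (\<G> \<C>) (T k)) C = emeasure (distr M (\<G> \<C>) (\<lambda>x. x)) C"
      using cylinder_transport[OF D, of k] measurable_T[of k] id
      by (simp add: emeasure_distr emeasure_eq_measure)
  next
    have "space M = {\<omega> \<in> space M. (\<lambda>A\<in>{}. X A \<omega>) \<in> space (PiM {} (\<lambda>_. borel))}" by (auto simp: space_PiM)
    then have "space M \<in> cylinders (space M) \<C> X"
      unfolding cylinders_def by blast
    then show "range (\<lambda>_::nat. space M) \<subseteq> cylinders (space M) \<C> X" by auto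
    show "emeasure (distr M (\<G> \<C>) (T k)) (space M) \<noteq> \<infinity>" for i :: nat
      using finite_measure.emeasure_finite[OF finite_measure_distr[OF measurable_T[of k]]] by auto
  qed (simp_all add: sets_sigma_gen_cylinders)
  then have "measure (distr M (\<G> \<C>) (T k)) E = measure (distr M (\<G> \<C>) (\<lambda>x. x)) E" by simp
  moreover have "E \<inter> space M = E" using sets.sets_into_space[OF assms] by auto
  ultimately show ?thesis using assms measurable_T[of k] id by (simp add: measure_distr)
qed

text \<open>
  For cylinder events the limit is attained after finitely many steps: once \<open>\<phi> k\<close> has moved
  the finitely many cells behind \<open>E\<close> away from those behind \<open>F\<close>, the events
  \<open>T k -` E\<close> and \<open>F\<close> are independent, and \<open>T k\<close> preserves the
  measure of \<open>E\<close>.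
\<close>

theorem mixing:
  assumes D1: "D1 \<subseteq> \<C>" and D2: "D2 \<subseteq> \<C>"
    and apart: "\<And>A B. A \<in> D1 \<Longrightarrow> B \<in> D2 \<Longrightarrow> \<forall>\<^sub>F k in sequentially. A \<in> \<C>' k \<and> \<phi> k -` A \<inter> B = {}"
    and E: "E \<in> sets (\<G> D1)" and F: "F \<in> sets (\<G> D2)"
  shows "(\<lambda>k. prob (T k -` E \<inter> F)) \<longlonglongrightarrow> prob E * prob F"
proof (rule mixing_extends[OF Int_stable_cylinders _ Int_stable_cylinders])
  have *: "sigma_sets (space M) (cylinders (space M) D1 X) \<subseteq> sets (\<G> \<C>)"
    using D1 unfolding sets_sigma_gen_cylinders by (intro sigma_sets_mono') (auto simp: cylinders_def)
  show "T k -` E \<inter> space M \<in> events" if "E \<in> sigma_sets (space M) (cylinders (space M) D1 X)" for k E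
    using measurable_T * that by (blast intro: measurable_sets)
  show "prob (T k -` E \<inter> space M) = prob E" if "E \<in> sigma_sets (space M) (cylinders (space M) D1 X)" for k E
    using measure_preserving * that by blast
  show "cylinders (space M) D1 X \<subseteq> events" "cylinders (space M) D2 X \<subseteq> events"
    using sets_\<G>[OF D1] sets_\<G>[OF D2] by (auto simp: sets_sigma_gen_cylinders)
  show "E \<in> sigma_sets (space M) (cylinders (space M) D1 X)" "F \<in> sigma_sets (space M) (cylinders (space M) D2 X)"
    using E F by (auto simp: sets_sigma_gen_cylinders)
  fix E F assume "E \<in> cylinders (space M) D1 X" "F \<in> cylinders (space M) D2 X"
  then obtain I J B C where I: "finite I" "I \<subseteq> D1" "B \<in> sets (PiM I (\<lambda>_. borel))" and Eeq: "E = {\<omega> \<in> space M. (\<lambda>A\<in>I. X A \<omega>) \<in> B}"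
    and J: "finite J" "J \<subseteq> D2" "C \<in> sets (PiM J (\<lambda>_. borel))" and Feq: "F = {\<omega> \<in> space M. (\<lambda>A\<in>J. X A \<omega>) \<in> C}"
    by (auto simp: cylinders_def)
  have "\<forall>\<^sub>F k in sequentially. \<forall>A\<in>I. \<forall>B\<in>J. A \<in> \<C>' k \<and> \<phi> k -` A \<inter> B = {}"
    using I J apart by (auto intro!: eventually_ball_finite)
  then have "\<forall>\<^sub>F k in sequentially. prob (T k -` E \<inter> F) = prob E * prob F"
  proof (cases "J = {}")
    case True
    \<comment> \<open>Without a cell behind \<open>F\<close>, the assumption of separation says nothing; but then \<open>F\<close> is empty or everything.\<close>
    have "prob (T k -` E \<inter> F) = prob E * prob F" for k
    proof -
      have "F = {} \<or> F = space M" unfolding Feq True by (auto simp: restrict_def)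
      moreover have "prob (T k -` E \<inter> space M) = prob E"
        using * \<open>E \<in> cylinders (space M) D1 X\<close> by (intro measure_preserving) auto
      ultimately show ?thesis by (auto simp: prob_space)
    qed
    then show ?thesis by simp
  next
    case False
    from \<open>\<forall>\<^sub>F k in sequentially. \<forall>A\<in>I. \<forall>B\<in>J. A \<in> \<C>' k \<and> \<phi> k -` A \<inter> B = {}\<close>
    show ?thesis
    proof (elim eventually_mono)
      fix k assume k: "\<forall>A\<in>I. \<forall>B\<in>J. A \<in> \<C>' k \<and> \<phi> k -` A \<inter> B = {}"
      have IC: "A \<in> \<C>' k" if "A \<in> I" for A using k False that by auto
      define I' where "I' = (\<lambda>A. \<phi> k -` A) ` I"
      define R where "R y = (\<lambda>A\<in>I. y (\<phi> k -` A))" for y :: "'x set \<Rightarrow> 'v"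
      have R: "R \<in> PiM I' (\<lambda>_. borel) \<rightarrow>\<^sub>M PiM I (\<lambda>_. borel)"
        unfolding R_def I'_def by (intro measurable_restrict measurable_component_singleton) auto
      have "indep_var (PiM I' (\<lambda>_. borel)) (\<lambda>\<omega>. \<lambda>A\<in>I'. X A \<omega>) (PiM J (\<lambda>_. borel)) (\<lambda>\<omega>. \<lambda>A\<in>J. X A \<omega>)"
      proof (rule indep_disjoint_supports)
        show "A \<inter> B = {}" if "A \<in> I'" "B \<in> J" for A B using k that by (fastforce simp: I'_def)
      qed (use I J D2 IC vimage in \<open>auto simp: I'_def\<close>)
      from indep_var_compose[OF this R measurable_ident]
      have "indep_var (PiM I (\<lambda>_. borel)) (\<lambda>\<omega>. \<lambda>A\<in>I. X A (T k \<omega>)) (PiM J (\<lambda>_. borel)) (\<lambda>\<omega>. \<lambda>A\<in>J. X A \<omega>)"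
        by (simp add: R_def I'_def comp_def transport IC cong: restrict_cong)
      from indep_varD[OF this I(3) J(3)] cylinder_transport[OF I(1) _ I(3), of k] I(2) D1
      have "prob ((\<lambda>\<omega>. (\<lambda>A\<in>I. X A (T k \<omega>), \<lambda>A\<in>J. X A \<omega>)) -` (B \<times> C) \<inter> space M)
        = prob ((\<lambda>\<omega>. \<lambda>A\<in>I. X A \<omega>) -` B \<inter> space M) * prob ((\<lambda>\<omega>. \<lambda>A\<in>J. X A \<omega>) -` C \<inter> space M)" by auto
      moreover have "(\<lambda>\<omega>. (\<lambda>A\<in>I. X A (T k \<omega>), \<lambda>A\<in>J. X A \<omega>)) -` (B \<times> C) \<inter> space M = T k -` E \<inter> F"
        using T_space by (auto simp: Eeq Feq)
      moreover have "(\<lambda>\<omega>. \<lambda>A\<in>I. X A \<omega>) -` B \<inter> space M = E" "(\<lambda>\<omega>. \<lambda>A\<in>J. X A \<omega>) -` C \<inter> space M = F"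
        by (auto simp: Eeq Feq)
      ultimately show "prob (T k -` E \<inter> F) = prob E * prob F" by simp
    qed
  qed
  then show "(\<lambda>k. prob (T k -` E \<inter> F)) \<longlonglongrightarrow> prob E * prob F"
    by (rule tendsto_eventually)
qed (rule T_space)

end

section \<open>Poisson random measures\<close>

lemma point_count_Union:
  assumes "finite P" "disjoint P"
  shows "point_count p (\<Union>P) = (\<Sum>A\<in>P. point_count p A)"
proof -
  let ?F = "\<lambda>A. {r. \<exists>e. p r = Some e \<and> (r, e) \<in> A}"
  have "(\<Sum>A\<in>P. emeasure (count_space UNIV) (?F A)) = emeasure (count_space UNIV) (\<Union>A\<in>P. ?F A)"
    by (rule sum_emeasure) (use assms in \<open>fastforce simp: disjoint_family_on_def disjoint_def\<close>)+
  moreover have "(\<Union>A\<in>P. ?F A) = ?F (\<Union>P)" by auto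
  ultimately show ?thesis by (simp add: point_count_def)
qed

text \<open>
  Moving the points of \<open>p\<close> forward is the same as moving the counting window back;
  \<open>swap_time\<close> is its own inverse.
\<close>

lemma point_count_tau2:
  "point_count (tau2 t l p) A = point_count p (map_prod (swap_time t l) id -` A)"
proof -
  let ?S = "{r. \<exists>e. p r = Some e \<and> (swap_time t l r, e) \<in> A}"
  have inj: "inj (swap_time t l)" by (metis injI swap_time_swap_time)
  have "{r. \<exists>e. p (swap_time t l r) = Some e \<and> (r, e) \<in> A} = swap_time t l ` ?S"
    by (force simp: image_iff)
  then have "point_count (tau2 t l p) A = emeasure (count_space UNIV) (swap_time t l ` ?S)"
    by (simp add: point_count_def tau2_def)
  also have "\<dots> = emeasure (count_space UNIV) ?S"
    using inj_on_subset[OF inj subset_UNIV, of ?S]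
    by (simp add: emeasure_count_space card_image finite_image_iff)
  finally show ?thesis by (simp add: point_count_def)
qed

lemma measurable_swap_time [measurable]: "swap_time t l \<in> borel_measurable borel"
  unfolding swap_time_def[abs_def] by measurable

lemma lborel_translate: "B \<in> sets borel \<Longrightarrow> emeasure lborel ((\<lambda>x. x + c) -` B) = emeasure lborel (B :: real set)"
  using lborel_distr_plus[of c] emeasure_distr[of "(+) c" lborel borel B] by (simp add: add.commute[of _ c])

text \<open>
  The time exchange is piecewise a translation: by \<open>- l\<close> on the later of the exchanged
  intervals, by \<open>l\<close> on the earlier one, by \<open>0\<close> elsewhere.
\<close>

lemma emeasure_lborel_swap_time:
  assumes [measurable]: "B \<in> sets borel"
  shows "emeasure lborel (swap_time t l -` B) = emeasure lborel B"
proof -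
  define I J where "I = {t - real l<..t}" and "J = {t - 2 * real l<..t - real l}"
  have [measurable]: "I \<in> sets borel" "J \<in> sets borel" by (auto simp: I_def J_def)
  have [measurable]: "(\<lambda>x. x + c) -` A \<in> sets borel" if [measurable]: "A \<in> sets borel" for c and A :: "real set"
    using measurable_sets_borel[of "\<lambda>x. x + c" borel A] by simp
  have IJ: "I \<inter> J = {}" by (auto simp: I_def J_def)
  have v: "swap_time t l -` B = (\<lambda>x. x + - real l) -` (J \<inter> B) \<union> (\<lambda>x. x + real l) -` (I \<inter> B) \<union> (B - I - J)"
    unfolding I_def J_def swap_time_def by (auto split: if_splits)
  have sub: "(\<lambda>x. x + - real l) -` (J \<inter> B) \<subseteq> I" "(\<lambda>x. x + real l) -` (I \<inter> B) \<subseteq> J"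
    by (auto simp: I_def J_def)
  have "emeasure lborel (swap_time t l -` B) =
      emeasure lborel ((\<lambda>x. x + - real l) -` (J \<inter> B)) + emeasure lborel ((\<lambda>x. x + real l) -` (I \<inter> B)) + emeasure lborel (B - I - J)"
    unfolding v using sub IJ by (subst plus_emeasure[symmetric], simp, simp, blast)+ simp
  also have "\<dots> = emeasure lborel (J \<inter> B) + emeasure lborel (I \<inter> B) + emeasure lborel (B - I - J)"
    by (simp only: lborel_translate[OF sets.Int[OF \<open>J \<in> sets borel\<close> assms]] lborel_translate[OF sets.Int[OF \<open>I \<in> sets borel\<close> assms]])
  also have "\<dots> = emeasure lborel (J \<inter> B \<union> I \<inter> B \<union> (B - I - J))"
    using IJ by (subst plus_emeasure, simp, simp, blast)+ simp
  also have "J \<inter> B \<union> I \<inter> B \<union> (B - I - J) = B" by auto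
  finally show ?thesis .
qed

lemma vimage_swap_time_prod:
  assumes "A \<in> sets (lborel \<Otimes>\<^sub>M M)"
  shows "map_prod (swap_time t l) id -` A \<in> sets (lborel \<Otimes>\<^sub>M M)"
proof -
  have "map_prod (swap_time t l) id \<in> lborel \<Otimes>\<^sub>M M \<rightarrow>\<^sub>M lborel \<Otimes>\<^sub>M M"
    unfolding map_prod_def split_beta id_def by measurable
  from measurable_sets[OF this assms]
  have "map_prod (swap_time t l) id -` A \<inter> space (lborel \<Otimes>\<^sub>M M) \<in> sets (lborel \<Otimes>\<^sub>M M)" .
  moreover have "map_prod (swap_time t l) id -` A \<inter> space (lborel \<Otimes>\<^sub>M M) = map_prod (swap_time t l) id -` A"
    using sets.sets_into_space[OF assms] by (auto simp: space_pair_measure)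
  ultimately show ?thesis by simp
qed

lemma emeasure_swap_time_prod:
  assumes M: "sigma_finite_measure M" and A: "A \<in> sets (lborel \<Otimes>\<^sub>M M)"
  shows "emeasure (lborel \<Otimes>\<^sub>M M) (map_prod (swap_time t l) id -` A) = emeasure (lborel \<Otimes>\<^sub>M M) A"
proof -
  interpret M: sigma_finite_measure M by fact
  interpret pair_sigma_finite lborel M ..
  have "emeasure lborel ((\<lambda>x. (x, y)) -` (map_prod (swap_time t l) id -` A)) = emeasure lborel ((\<lambda>x. (x, y)) -` A)" for y
  proof -
    have "(\<lambda>x. (x, y)) -` (map_prod (swap_time t l) id -` A) = swap_time t l -` ((\<lambda>x. (x, y)) -` A)" by auto
    then show ?thesis using sets_Pair2[OF A, of y] by (simp add: emeasure_lborel_swap_time)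
  qed
  then show ?thesis
    by (simp add: emeasure_pair_measure_alt2[OF A] emeasure_pair_measure_alt2[OF vimage_swap_time_prod[OF A]])
qed

text \<open>
  The pieces are the nonempty atoms of the finite algebra generated by \<open>D\<close>.
\<close>

lemma atoms_refine:
  assumes "finite D" "D \<subseteq> sets N"
  obtains P where "finite P" "disjoint P" "{} \<notin> P" "P \<subseteq> sets N" "\<And>A. A \<in> D \<Longrightarrow> A = \<Union>{Q\<in>P. Q \<subseteq> A}"
proof
  define c where "c S = {y\<in>space N. \<forall>A\<in>D. y \<in> A \<longleftrightarrow> A \<in> S}" for S
  define P where "P = c ` Pow D - {{}}"
  show "finite P" using assms by (auto simp: P_def)
  show "disjoint P" unfolding disjoint_def P_def c_def by auto
  show "{} \<notin> P" by (simp add: P_def)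
  have "c S \<in> sets N" for S
    unfolding c_def using assms by (intro sets.sets_Collect_finite_All) (auto simp: sets.sets_Collect_finite_All')
  then show "P \<subseteq> sets N" by (auto simp: P_def)
  fix A assume A: "A \<in> D"
  have "\<exists>Q\<in>P. Q \<subseteq> A \<and> x \<in> Q" if "x \<in> A" for x
  proof (rule bexI[of _ "c {B\<in>D. x \<in> B}"])
    show *: "c {B\<in>D. x \<in> B} \<subseteq> A \<and> x \<in> c {B\<in>D. x \<in> B}"
      using A that assms sets.sets_into_space[of A N] by (auto simp: c_def)
    then show "c {B\<in>D. x \<in> B} \<in> P" by (auto simp: P_def)
  qed
  then show "A = \<Union>{Q\<in>P. Q \<subseteq> A}" by blast
qed

text \<open>
  If the point masses at natural numbers add up to one, then they determine the law, although the variable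
  could a priori take any value in \<open>[0, \<infinity>]\<close>.
\<close>

lemma (in prob_space) prob_nat_valued:
  fixes X :: "'a \<Rightarrow> ennreal"
  assumes X [measurable]: "X \<in> borel_measurable M" and sums: "(\<lambda>k. prob {\<omega> \<in> space M. X \<omega> = of_nat k}) sums 1"
    and B [measurable]: "B \<in> sets borel"
  shows "prob (X -` B \<inter> space M) = (\<Sum>k. if of_nat k \<in> B then prob {\<omega> \<in> space M. X \<omega> = of_nat k} else 0)"
proof -
  let ?E = "\<lambda>k. {\<omega> \<in> space M. X \<omega> = of_nat k}"
  have d: "disjoint_family ?E" by (auto simp: disjoint_family_on_def)
  have "prob (\<Union>k. ?E k) = 1"
    using finite_measure_UNION[of ?E] d sums by (simp add: sums_iff image_subset_iff)
  then have "AE \<omega> in M. \<omega> \<in> (\<Union>k. ?E k)" by (subst prob_eq_1[symmetric]) auto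
  then have "prob (X -` B \<inter> space M) = prob (\<Union>k. X -` B \<inter> ?E k)"
  proof (intro measure_eq_AE)
    have "(\<Union>k. X -` B \<inter> ?E k) = (X -` B \<inter> space M) \<inter> (\<Union>k. ?E k)" by auto
    then show "(\<Union>k. X -` B \<inter> ?E k) \<in> events" by simp
  qed (auto elim!: eventually_mono)
  also have "\<dots> = (\<Sum>k. prob (X -` B \<inter> ?E k))"
  proof (rule sums_unique, rule finite_measure_UNION)
    have "X -` B \<inter> ?E k = {\<omega> \<in> space M. X \<omega> \<in> B \<and> X \<omega> = of_nat k}" for k by auto
    then show "range (\<lambda>k. X -` B \<inter> ?E k) \<subseteq> events" by auto
  qed (use d in \<open>auto simp: disjoint_family_on_def\<close>)
  also have "(\<lambda>k. prob (X -` B \<inter> ?E k)) = (\<lambda>k. if of_nat k \<in> B then prob (?E k) else 0)"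
  proof
    fix k
    have "X -` B \<inter> ?E k = (if of_nat k \<in> B then ?E k else {})" by auto
    then show "prob (X -` B \<inter> ?E k) = (if of_nat k \<in> B then prob (?E k) else 0)" by simp
  qed
  finally show ?thesis .
qed

lemma poisson_random_measure_law:
  assumes N: "poisson_random_measure P N \<nu>" and A: "A \<in> sets \<nu>" "B \<in> sets \<nu>" "emeasure \<nu> A = emeasure \<nu> B"
  shows "distr P borel (\<lambda>\<omega>. N \<omega> A) = distr P borel (\<lambda>\<omega>. N \<omega> B)"
proof -
  interpret prob_space P using N by (simp add: poisson_random_measure_def)
  have rv: "(\<lambda>\<omega>. N \<omega> A) \<in> borel_measurable P" "(\<lambda>\<omega>. N \<omega> B) \<in> borel_measurable P"
    using N A by (auto simp: poisson_random_measure_def)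
  show ?thesis
  proof (cases "emeasure \<nu> A = \<infinity>")
    case True
    then have "AE \<omega> in P. N \<omega> A = \<infinity>" "AE \<omega> in P. N \<omega> B = \<infinity>"
      using N A by (auto simp: poisson_random_measure_def)
    then have "AE \<omega> in P. N \<omega> A = N \<omega> B" by eventually_elim simp
    then show ?thesis using rv by (intro distr_cong_AE) auto
  next
    case False
    have p: "prob {\<omega> \<in> space P. N \<omega> C = of_nat k} = measure \<nu> A ^ k / fact k * exp (- measure \<nu> A)" if "C = A \<or> C = B" for C k
      using that N A False by (auto simp: poisson_random_measure_def less_top measure_def)
    have "(\<lambda>k. measure \<nu> A ^ k / fact k * exp (- measure \<nu> A)) sums (exp (measure \<nu> A) * exp (- measure \<nu> A))"
      using exp_converges[of "measure \<nu> A"] by (intro sums_mult2) (simp add: divide_inverse_commute)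
    then have s: "(\<lambda>k. prob {\<omega> \<in> space P. N \<omega> C = of_nat k}) sums 1" if "C = A \<or> C = B" for C
      using that by (simp add: p mult_exp_exp)
    show ?thesis
    proof (rule measure_eqI)
      fix Y assume "Y \<in> sets (distr P borel (\<lambda>\<omega>. N \<omega> A))"
      then have Y: "Y \<in> sets borel" by simp
      show "emeasure (distr P borel (\<lambda>\<omega>. N \<omega> A)) Y = emeasure (distr P borel (\<lambda>\<omega>. N \<omega> B)) Y"
        using prob_nat_valued[OF rv(1) s Y] prob_nat_valued[OF rv(2) s Y] rv Y
        by (simp add: emeasure_distr emeasure_eq_measure p cong: if_cong)
    qed simp
  qed
qed

text \<open>
  Only a change of index set: the definition speaks of families indexed by \<open>{..<n}\<close>, while the
  cells of a scattered field index themselves.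
\<close>

lemma poisson_random_measure_indep:
  assumes N: "poisson_random_measure P N \<nu>" and D: "finite D" "D \<subseteq> sets \<nu>" "disjoint D"
  shows "prob_space.indep_vars P (\<lambda>_. borel) (\<lambda>A \<omega>. N \<omega> A) D"
proof -
  interpret prob_space P using N by (simp add: poisson_random_measure_def)
  obtain f where f: "bij_betw f {..<card D} D"
    using ex_bij_betw_nat_finite[OF D(1)] by (auto simp: atLeast0LessThan)
  have "disjoint_family_on f {..<card D}"
    unfolding disjoint_family_on_def
  proof (intro ballI impI)
    fix m n assume mn: "m \<in> {..<card D}" "n \<in> {..<card D}" "m \<noteq> n"
    then have "f m \<in> D" "f n \<in> D" "f m \<noteq> f n" using f by (auto simp: bij_betw_def inj_on_def)
    then show "f m \<inter> f n = {}" using D(3) by (simp add: disjoint_def)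
  qed
  moreover have "f ` {..<card D} \<subseteq> sets \<nu>" using f D by (simp add: bij_betw_def)
  ultimately have ind: "indep_vars (\<lambda>_. borel) (\<lambda>i \<omega>. N \<omega> (f i)) {..<card D}"
    using N by (auto simp: poisson_random_measure_def)
  let ?g = "inv_into {..<card D} f"
  have g: "bij_betw ?g D {..<card D}" using f by (rule bij_betw_inv_into)
  have "indep_vars (\<lambda>_. borel) (\<lambda>A \<omega>. N \<omega> (f (?g A))) D"
    using indep_vars_reindex_inj[of ?g D "\<lambda>_. borel" "\<lambda>i \<omega>. N \<omega> (f i)"] g ind by (simp add: bij_betw_def)
  then show ?thesis
    by (subst indep_vars_cong[OF refl _ refl]) (use f in \<open>auto simp: bij_betw_inv_into_right\<close>)
qed

text \<open>
  Counts are measurable for the completion of \<open>Q\<close> only, so the field lives there. All measurable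
  sets serve as cells, and all are admissible for the exchange because \<open>swap_time\<close> is measurable.
\<close>

lemma scattered_field_poisson:
  assumes lam: "sigma_finite_measure lam" and Q: "poisson_space lam Q"
  shows "scattered_field (completion Q) (sets (lborel \<Otimes>\<^sub>M lam)) (\<lambda>A p. point_count p A) (emeasure (lborel \<Otimes>\<^sub>M lam))
     (\<lambda>l. map_prod (swap_time t l) id) (\<lambda>l. tau2 t l) (\<lambda>_. sets (lborel \<Otimes>\<^sub>M lam))"
proof -
  have N: "poisson_random_measure (completion Q) point_count (lborel \<Otimes>\<^sub>M lam)" and sp: "space Q = point_functions"
    using Q by (auto simp: poisson_space_def)
  interpret prob_space "completion Q" using N by (simp add: poisson_random_measure_def)
  show ?thesis
  proof unfold_locales
    show "surj (map_prod (swap_time t k) id)" for k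
      by (intro map_prod_surj surjI[of _ "swap_time t k"]) auto
    show "\<exists>P. finite P \<and> disjoint P \<and> {} \<notin> P \<and> P \<subseteq> sets (lborel \<Otimes>\<^sub>M lam) \<and>
         (\<forall>A\<in>D. \<forall>\<omega>. point_count \<omega> A = (\<Sum>Q | Q \<in> P \<and> Q \<subseteq> A. point_count \<omega> Q))"
      if D: "finite D" "D \<subseteq> sets (lborel \<Otimes>\<^sub>M lam)" for D
    proof (rule atoms_refine[OF D])
      fix P assume P: "finite P" "disjoint P" "{} \<notin> P" "P \<subseteq> sets (lborel \<Otimes>\<^sub>M lam)" and U: "\<And>A. A \<in> D \<Longrightarrow> A = \<Union>{Q\<in>P. Q \<subseteq> A}"
      have "point_count \<omega> A = (\<Sum>Q | Q \<in> P \<and> Q \<subseteq> A. point_count \<omega> Q)" if "A \<in> D" for A \<omega>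
        using P by (subst U[OF that], subst point_count_Union) (auto simp: disjoint_def)
      then show ?thesis using P by blast
    qed
  next
    show "(\<lambda>p. point_count p A) \<in> borel_measurable (completion Q)" if "A \<in> sets (lborel \<Otimes>\<^sub>M lam)" for A
      using N that by (simp add: poisson_random_measure_def)
    show "tau2 t k p \<in> space (completion Q)" if "p \<in> space (completion Q)" for p k
      using that tau2_point_functions by (simp add: sp)
  qed ((rule point_count_tau2 subset_refl poisson_random_measure_law[OF N]
      poisson_random_measure_indep[OF N] vimage_swap_time_prod emeasure_swap_time_prod[OF lam] | assumption)+)
qed

section \<open>Increments over half-open intervals\<close>

lemma surj_swap_time: "surj (swap_time t l)"
  by (rule surjI) (rule swap_time_swap_time)

definition half_open :: "real set set" where
  "half_open = {{a<..b} | a b. a < b}"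

text \<open>
  The increment of \<open>w\<close> over a half-open interval, written as a function of the interval so that
  intervals can serve as cells.
\<close>

definition set_incr :: "real set \<Rightarrow> (real \<Rightarrow> 'v) \<Rightarrow> 'v::ab_group_add" where
  "set_incr A w = incr w (Inf A) (Sup A)"

lemma half_openI: "a < b \<Longrightarrow> {a<..b} \<in> half_open"
  by (auto simp: half_open_def)

lemma set_incr_Ioc [simp]: "a < b \<Longrightarrow> set_incr {a<..b} w = w b - w a"
  by (simp add: set_incr_def incr_def)

definition neighbour_intervals :: "real set \<Rightarrow> real set set" where
  "neighbour_intervals F = {{a<..b} | a b. a \<in> F \<and> b \<in> F \<and> a < b \<and> {a<..<b} \<inter> F = {}}"

lemma finite_neighbour_intervals: "finite F \<Longrightarrow> finite (neighbour_intervals F)"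
proof -
  assume "finite F"
  have "neighbour_intervals F \<subseteq> (\<lambda>(a, b). {a<..b}) ` (F \<times> F)" by (auto simp: neighbour_intervals_def)
  with \<open>finite F\<close> show ?thesis by (meson finite_SigmaI finite_imageI finite_subset)
qed

lemma disjoint_neighbour_intervals: "disjoint (neighbour_intervals F)"
  unfolding disjoint_def
proof (intro ballI impI)
  fix P Q assume "P \<in> neighbour_intervals F" "Q \<in> neighbour_intervals F" "P \<noteq> Q"
  then obtain a b c d where P: "P = {a<..b}" "a \<in> F" "b \<in> F" "a < b" "{a<..<b} \<inter> F = {}"
    and Q: "Q = {c<..d}" "c \<in> F" "d \<in> F" "c < d" "{c<..<d} \<inter> F = {}" by (auto simp: neighbour_intervals_def)
  have "c \<notin> {a<..<b}" "d \<notin> {a<..<b}" "a \<notin> {c<..<d}" "b \<notin> {c<..<d}" using P Q by blast+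
  then show "P \<inter> Q = {}" using P Q \<open>P \<noteq> Q\<close> by (auto simp: not_less)
qed

text \<open>
  Telescoping. The induction peels off the last cell, whose left end point is the predecessor \<open>c\<close>
  of \<open>v\<close> in \<open>F\<close>.
\<close>

lemma sum_set_incr_neighbour_intervals:
  assumes F: "finite F" "u \<in> F" "v \<in> F" "u \<le> v"
  shows "(\<Sum>Q\<in>{Q\<in>neighbour_intervals F. Q \<subseteq> {u<..v}}. set_incr Q w) = w v - w u"
  using F(3,4)
proof (induction "card {x\<in>F. x < v}" arbitrary: v rule: less_induct)
  case less
  show ?case
  proof (cases "u = v")
    case True
    then have "{Q\<in>neighbour_intervals F. Q \<subseteq> {u<..v}} = {}" by (auto simp: neighbour_intervals_def)
    then show ?thesis using True by (simp only: sum.empty) simp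
  next
    case False
    define c where "c = Max {x\<in>F. x < v}"
    have fin: "finite {x\<in>F. x < v}" and ne: "u \<in> {x\<in>F. x < v}" using F less False by auto
    have c: "c \<in> F" "c < v" "u \<le> c" using Max_in[OF fin] Max_ge[OF fin ne] ne by (auto simp: c_def)
    have cmax: "x \<le> c" if "x \<in> F" "x < v" for x using Max_ge[OF fin] that by (auto simp: c_def)
    have "{Q\<in>neighbour_intervals F. Q \<subseteq> {u<..v}} = insert {c<..v} {Q\<in>neighbour_intervals F. Q \<subseteq> {u<..c}}"
    proof (intro set_eqI iffI)
      fix Q assume "Q \<in> {Q\<in>neighbour_intervals F. Q \<subseteq> {u<..v}}"
      then have QF: "Q \<in> neighbour_intervals F" and "Q \<subseteq> {u<..v}" by auto
      then obtain a b where ab: "Q = {a<..b}" "a \<in> F" "b \<in> F" "a < b" "{a<..<b} \<inter> F = {}"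
        unfolding neighbour_intervals_def by blast
      with \<open>Q \<subseteq> {u<..v}\<close> have "u \<le> a" "b \<le> v" using Ioc_subset_iff[of a b u v] by auto
      note Q = ab this
      show "Q \<in> insert {c<..v} {Q\<in>neighbour_intervals F. Q \<subseteq> {u<..c}}"
      proof (cases "b = v")
        case True
        have "c \<notin> {a<..<b}" using Q c by blast
        then have "a = c" using cmax[of a] Q True c by (auto simp: not_less)
        then show ?thesis using Q True by simp
      next
        case False
        then have "b \<le> c" using cmax[of b] Q by auto
        then show ?thesis using Q QF by auto
      qed
    next
      fix Q assume "Q \<in> insert {c<..v} {Q\<in>neighbour_intervals F. Q \<subseteq> {u<..c}}"
      moreover have "{c<..v} \<in> neighbour_intervals F"
        unfolding neighbour_intervals_def using c less.prems(1) cmax by (intro CollectI exI[of _ c] exI[of _ v]) force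
      ultimately show "Q \<in> {Q\<in>neighbour_intervals F. Q \<subseteq> {u<..v}}" using c by auto
    qed
    moreover have "{c<..v} \<notin> {Q\<in>neighbour_intervals F. Q \<subseteq> {u<..c}}" using c by auto
    moreover have "finite {Q\<in>neighbour_intervals F. Q \<subseteq> {u<..c}}" using finite_neighbour_intervals[OF F(1)] by simp
    moreover have "(\<Sum>Q\<in>{Q\<in>neighbour_intervals F. Q \<subseteq> {u<..c}}. set_incr Q w) = w c - w u"
    proof (rule less.hyps)
      show "card {x\<in>F. x < c} < card {x\<in>F. x < v}"
        using fin c by (intro psubset_card_mono) auto
    qed (use c in auto)
    ultimately show ?thesis using c by simp
  qed
qed

text \<open>
  The half-open intervals with none of the break points of the exchange in their interior; on each of these
  \<open>swap_time t l\<close> is a single translation.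
\<close>

definition unstraddled :: "real \<Rightarrow> nat \<Rightarrow> real set set" where
  "unstraddled t l = {{a<..b} | a b. a < b \<and>
     (\<forall>c\<in>{t - 2 * real l, t - real l, t}. b \<le> c \<or> c \<le> a)}"

lemma half_open_refine:
  assumes "finite D" "D \<subseteq> half_open"
  obtains P where "finite P" "disjoint P" "{} \<notin> P" "P \<subseteq> unstraddled t l"
    "\<And>A w. A \<in> D \<Longrightarrow> set_incr A w = (\<Sum>Q\<in>{Q\<in>P. Q \<subseteq> A}. set_incr Q w)"
proof
  define F where "F = {t - 2 * real l, t - real l, t} \<union> Inf ` D \<union> Sup ` D"
  have F: "finite F" using assms by (simp add: F_def)
  show "finite (neighbour_intervals F)" "disjoint (neighbour_intervals F)" using F finite_neighbour_intervals disjoint_neighbour_intervals by auto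
  show "{} \<notin> neighbour_intervals F" by (auto simp: neighbour_intervals_def)
  show "neighbour_intervals F \<subseteq> unstraddled t l"
  proof
    fix Q assume "Q \<in> neighbour_intervals F"
    then obtain a b where Q: "Q = {a<..b}" "a < b" "{a<..<b} \<inter> F = {}" by (auto simp: neighbour_intervals_def)
    have "b \<le> c \<or> c \<le> a" if "c \<in> {t - 2 * real l, t - real l, t}" for c
    proof -
      have "c \<notin> {a<..<b}" using Q that unfolding F_def by blast
      then show ?thesis by auto
    qed
    then show "Q \<in> unstraddled t l" using Q unfolding unstraddled_def by blast
  qed
  fix A w assume "A \<in> D"
  then obtain a b where A: "A = {a<..b}" "a < b" using assms by (auto simp: half_open_def)
  then have "a \<in> F" "b \<in> F" using \<open>A \<in> D\<close> by (force simp: F_def)+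
  then show "set_incr A w = (\<Sum>Q\<in>{Q\<in>neighbour_intervals F. Q \<subseteq> A}. set_incr Q w)"
    using A sum_set_incr_neighbour_intervals[OF F, of a b w] by simp
qed

lemma swap_time_vimage_Ioc:
  assumes "a < b"
  shows "b \<le> t - 2 * real l \<Longrightarrow> swap_time t l -` {a<..b} = {a<..b}"
    and "t - 2 * real l \<le> a \<Longrightarrow> b \<le> t - real l \<Longrightarrow> swap_time t l -` {a<..b} = {a + real l<..b + real l}"
    and "t - real l \<le> a \<Longrightarrow> b \<le> t \<Longrightarrow> swap_time t l -` {a<..b} = {a - real l<..b - real l}"
    and "t \<le> a \<Longrightarrow> swap_time t l -` {a<..b} = {a<..b}"
  using assms by (auto simp: swap_time_def split: if_splits)

lemma unstraddled_vimage:
  assumes "A \<in> unstraddled t l"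
  shows "swap_time t l -` A \<in> half_open"
    and "Sup (swap_time t l -` A) - Inf (swap_time t l -` A) = Sup A - Inf A"
    and "set_incr A (tau1 t l w) = set_incr (swap_time t l -` A) w"
proof -
  obtain a b where A: "A = {a<..b}" and ab: "a < b" and c: "\<forall>c\<in>{t - 2 * real l, t - real l, t}. b \<le> c \<or> c \<le> a"
    using assms by (auto simp: unstraddled_def)
  have incr: "set_incr A (tau1 t l w) = tau1_pre t l w b - tau1_pre t l w a"
    using ab by (simp add: A tau1_eq)
  consider "b \<le> t - 2 * real l" | "t - 2 * real l \<le> a" "b \<le> t - real l" | "t - real l \<le> a" "b \<le> t" | "t \<le> a"
    using c by force
  then have "swap_time t l -` A \<in> half_open \<and> Sup (swap_time t l -` A) - Inf (swap_time t l -` A) = Sup A - Inf A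
    \<and> set_incr A (tau1 t l w) = set_incr (swap_time t l -` A) w"
  proof cases
    case 1
    then show ?thesis unfolding incr using ab swap_time_vimage_Ioc(1)[OF ab 1]
      by (auto simp: A half_openI tau1_pre_cases(1))
  next
    case 2
    then have *: "swap_time t l -` A = {a + real l<..b + real l}" using swap_time_vimage_Ioc(2)[OF ab] A by simp
    show ?thesis unfolding incr * using 2 ab
      by (auto simp: A half_openI tau1_pre_cases(2) incr_def)
  next
    case 3
    then have *: "swap_time t l -` A = {a - real l<..b - real l}" using swap_time_vimage_Ioc(3)[OF ab] A by simp
    show ?thesis unfolding incr * using 3 ab
      by (auto simp: A half_openI tau1_pre_cases(3))
  next
    case 4
    then show ?thesis unfolding incr using ab swap_time_vimage_Ioc(4)[OF ab 4]
      by (auto simp: A half_openI tau1_pre_cases(4))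
  qed
  then show "swap_time t l -` A \<in> half_open"
    and "Sup (swap_time t l -` A) - Inf (swap_time t l -` A) = Sup A - Inf A"
    and "set_incr A (tau1 t l w) = set_incr (swap_time t l -` A) w" by auto
qed

text \<open>
  Sort all end points together with \<open>0\<close>. The increments between neighbours are independent by
  definition, and the given increments are sums over disjoint groups of them.
\<close>

lemma brownian_increments_indep:
  assumes X: "brownian_motion M X" and I: "finite I" and ab: "\<And>i. i \<in> I \<Longrightarrow> 0 \<le> a i \<and> a i \<le> b i"
    and disj: "disjoint_family_on (\<lambda>i. {a i<..b i}) I"
  shows "prob_space.indep_vars M (\<lambda>_. borel) (\<lambda>i \<omega>. X (b i) \<omega> - X (a i) \<omega>) I"
proof -
  interpret prob_space M using X by (simp add: brownian_motion_def)
  define F where "F = insert 0 (a ` I \<union> b ` I)"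
  define n where "n = card F - 1"
  define u where "u = nth (sorted_list_of_set F)"
  have F: "finite F" "0 \<in> F" "\<And>x. x \<in> F \<Longrightarrow> 0 \<le> x" using I ab by (auto simp: F_def intro: order_trans)
  have n: "Suc n = card F" using F by (simp add: n_def card_gt_0_iff) (metis One_nat_def Suc_pred card_gt_0_iff empty_iff)
  have mono: "u i < u j" if "i < j" "j < card F" for i j
    unfolding u_def using strict_sorted_list_of_set[of F] that F(1) by (auto simp: sorted_wrt_iff_nth_less)
  have surj: "\<exists>i\<le>n. u i = x" if "x \<in> F" for x
    using that F(1) n unfolding u_def by (metis in_set_conv_nth less_Suc_eq_le length_sorted_list_of_set set_sorted_list_of_set)
  have uF: "u i \<in> F" if "i \<le> n" for i
    using that F(1) n unfolding u_def by (metis le_imp_less_Suc length_sorted_list_of_set nth_mem set_sorted_list_of_set)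
  have "0 \<le> u 0 \<and> (\<forall>i<n. u i < u (Suc i))"
    using F uF[of 0] mono n by auto
  then have ind: "indep_vars (\<lambda>_. borel) (\<lambda>k \<omega>. X (u (Suc k)) \<omega> - X (u k) \<omega>) {..<n}"
    using X unfolding brownian_motion_def by blast
  define K where "K i = {k\<in>{..<n}. a i \<le> u k \<and> u (Suc k) \<le> b i}" for i
  have K: "disjoint_family_on K I"
    unfolding disjoint_family_on_def
  proof (intro ballI impI)
    fix i j assume ij: "i \<in> I" "j \<in> I" "i \<noteq> j"
    have False if "k \<in> K i" "k \<in> K j" for k
    proof -
      have "u k < u (Suc k)" using that mono[of k "Suc k"] n by (auto simp: K_def)
      then have "u (Suc k) \<in> {a i<..b i} \<inter> {a j<..b j}" using that by (auto simp: K_def)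
      then show False using disjoint_family_onD[OF disj ij] by blast
    qed
    then show "K i \<inter> K j = {}" by blast
  qed
  have "indep_vars (\<lambda>i. PiM (K i) (\<lambda>_. borel)) (\<lambda>i \<omega>. \<lambda>k\<in>K i. X (u (Suc k)) \<omega> - X (u k) \<omega>) I"
    by (rule indep_vars_restrict[OF ind _ K]) (auto simp: K_def)
  then have "indep_vars (\<lambda>_. borel) (\<lambda>i \<omega>. \<Sum>k\<in>K i. (\<lambda>k\<in>K i. X (u (Suc k)) \<omega> - X (u k) \<omega>) k) I"
    by (rule indep_vars_compose2[where Y="\<lambda>i y. \<Sum>k\<in>K i. y k"])
       (auto intro!: borel_measurable_sum measurable_component_singleton)
  moreover have "(\<Sum>k\<in>K i. (\<lambda>k\<in>K i. X (u (Suc k)) \<omega> - X (u k) \<omega>) k) = X (b i) \<omega> - X (a i) \<omega>" if i: "i \<in> I" for i \<omega>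
  proof -
    obtain p q where p: "p \<le> n" "u p = a i" and q: "q \<le> n" "u q = b i"
      using surj[of "a i"] surj[of "b i"] i by (auto simp: F_def)
    have ule: "u k \<le> u m \<longleftrightarrow> k \<le> m" if "k \<le> n" "m \<le> n" for k m
      using mono[of k m] mono[of m k] that n by (metis le_less linorder_not_less less_Suc_eq_le)
    have "p \<le> q" using ule[OF p(1) q(1)] p q ab[OF i] by simp
    have "K i = {p..<q}"
      unfolding K_def using p q ule[of p] ule[of _ q]
      by (auto simp flip: p(2) q(2)) 
    then show ?thesis using sum_Suc_diff'[OF \<open>p \<le> q\<close>, of "\<lambda>k. X (u k) \<omega>"] p q by simp
  qed
  ultimately show ?thesis
    by (subst (asm) indep_vars_cong[OF refl _ refl, where Y="\<lambda>i \<omega>. X (b i) \<omega> - X (a i) \<omega>"]) (auto simp: fun_eq_iff)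
qed

text \<open>
  If the vectors \<open>Y\<close> and \<open>Z\<close> are independent and each has independent entries, then
  all entries \<open>Y i\<close> and \<open>Z i\<close> together are independent, and these can be regrouped
  by \<open>i\<close>.
\<close>

lemma (in prob_space) indep_vars_combine:
  assumes I: "finite I" and Y: "indep_vars (\<lambda>_. N) Y I" and Z: "indep_vars (\<lambda>_. N) Z I"
    and YZ: "indep_var (PiM I (\<lambda>_. N)) (\<lambda>\<omega>. \<lambda>i\<in>I. Y i \<omega>) (PiM I (\<lambda>_. N)) (\<lambda>\<omega>. \<lambda>i\<in>I. Z i \<omega>)"
    and g: "(\<lambda>(y, z). g y z) \<in> N \<Otimes>\<^sub>M N \<rightarrow>\<^sub>M L"
  shows "indep_vars (\<lambda>_. L) (\<lambda>i \<omega>. g (Y i \<omega>) (Z i \<omega>)) I"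
proof (cases "I = {}")
  case False
  define V where "V j = (if snd j then Y (fst j) else Z (fst j))" for j
  have rvY: "Y i \<in> M \<rightarrow>\<^sub>M N" and rvZ: "Z i \<in> M \<rightarrow>\<^sub>M N" if "i \<in> I" for i
    using Y Z that by (auto simp: indep_vars_def2)
  have rv: "V j \<in> M \<rightarrow>\<^sub>M N" if "j \<in> I \<times> UNIV" for j
    using that rvY rvZ by (auto simp: V_def)
  have "indep_vars (\<lambda>_. N) V (I \<times> (UNIV :: bool set))"
  proof (subst indep_vars_finite[where E="\<lambda>_. sets N"])
    show "\<forall>A\<in>I \<times> (UNIV :: bool set) \<rightarrow> sets N. prob (\<Inter>j\<in>I \<times> UNIV. V j -` A j \<inter> space M) = (\<Prod>j\<in>I \<times> UNIV. prob (V j -` A j \<inter> space M))"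
    proof
      fix A assume A: "A \<in> I \<times> (UNIV :: bool set) \<rightarrow> sets N"
      have box: "(\<Pi>\<^sub>E i\<in>I. A (i, b)) \<in> sets (PiM I (\<lambda>_. N))" for b
        using A I by (intro sets_PiM_I_finite) auto
      have pre: "(\<lambda>\<omega>. \<lambda>i\<in>I. W i \<omega>) -` (\<Pi>\<^sub>E i\<in>I. A (i, b)) \<inter> space M = (\<Inter>i\<in>I. W i -` A (i, b) \<inter> space M)" for W b
        using False by (auto simp: PiE_def Pi_def)
      have "(\<Inter>j\<in>I \<times> UNIV. V j -` A j \<inter> space M)
          = (\<lambda>\<omega>. (\<lambda>i\<in>I. Y i \<omega>, \<lambda>i\<in>I. Z i \<omega>)) -` ((\<Pi>\<^sub>E i\<in>I. A (i, True)) \<times> (\<Pi>\<^sub>E i\<in>I. A (i, False))) \<inter> space M"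
        using False by (auto simp: V_def PiE_def Pi_def UNIV_bool)
      then have "prob (\<Inter>j\<in>I \<times> UNIV. V j -` A j \<inter> space M)
          = prob (\<Inter>i\<in>I. Y i -` A (i, True) \<inter> space M) * prob (\<Inter>i\<in>I. Z i -` A (i, False) \<inter> space M)"
        using indep_varD[OF YZ box box, of True False] by (simp add: pre)
      also have "\<dots> = (\<Prod>i\<in>I. prob (Y i -` A (i, True) \<inter> space M)) * (\<Prod>i\<in>I. prob (Z i -` A (i, False) \<inter> space M))"
        using A False I by (intro arg_cong2[where f="(*)"] indep_varsD_finite[OF Y] indep_varsD_finite[OF Z]) auto
      also have "\<dots> = (\<Prod>i\<in>I. \<Prod>b\<in>UNIV. prob (V (i, b) -` A (i, b) \<inter> space M))"
        by (simp add: UNIV_bool prod.distrib V_def mult.commute)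
      also have "\<dots> = (\<Prod>j\<in>I \<times> UNIV. prob (V j -` A j \<inter> space M))"
        by (simp add: prod.cartesian_product split_beta)
      finally show "prob (\<Inter>j\<in>I \<times> UNIV. V j -` A j \<inter> space M) = (\<Prod>j\<in>I \<times> UNIV. prob (V j -` A j \<inter> space M))" .
    qed
  qed (use False I rv sets.space_closed[of N] in \<open>auto simp: Int_stable_def sets.sigma_sets_eq\<close>)
  then have "indep_vars (\<lambda>i. PiM ({i} \<times> UNIV) (\<lambda>_. N)) (\<lambda>i \<omega>. \<lambda>j\<in>{i} \<times> UNIV. V j \<omega>) I"
    by (rule indep_vars_restrict) (auto simp: disjoint_family_on_def)
  then have "indep_vars (\<lambda>_. L) (\<lambda>i \<omega>. (\<lambda>(y, z). g y z) ((\<lambda>j\<in>{i} \<times> UNIV. V j \<omega>) (i, True), (\<lambda>j\<in>{i} \<times> UNIV. V j \<omega>) (i, False))) I"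
    by (rule indep_vars_compose2[where Y="\<lambda>i y. (\<lambda>(y, z). g y z) (y (i, True), y (i, False))"])
       (intro measurable_compose[OF _ g] measurable_Pair measurable_component_singleton; simp)
  then show ?thesis by (simp add: V_def)
qed (simp add: indep_vars_def2 indep_sets_def)

section \<open>The two-sided Wiener measure\<close>

text \<open>
  Needed for increments before time \<open>0\<close>: the process \<open>s \<mapsto> \<omega>(- s)\<close>
  runs through an interval in the opposite direction, so that its increments are the negatives of those of
  \<open>\<omega>\<close>.
\<close>

lemma distr_uminus_even_density:
  fixes X :: "'a \<Rightarrow> 'b::euclidean_space"
  assumes X: "distributed M lborel X f" and f: "\<And>x. f (- x) = f x"
  shows "distr M borel (\<lambda>\<omega>. - X \<omega>) = distr M borel X"
proof -
  have [measurable]: "X \<in> borel_measurable M" "f \<in> borel_measurable borel"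
    using distributed_measurable[OF X] distributed_borel_measurable[OF X] by auto
  have d: "distr M borel X = density lborel f"
    using distributed_distr_eq_density[OF X] by (simp cong: distr_cong)
  have lb: "distr lborel borel uminus = (lborel :: 'b measure)"
    using lborel_affine[of "- 1" "0 :: 'b"] by (simp add: density_1)
  have "distr M borel (\<lambda>\<omega>. - X \<omega>) = distr (distr M borel X) borel uminus"
    by (simp add: distr_distr comp_def)
  also have "\<dots> = distr (density lborel f) borel uminus" by (simp add: d)
  also have "\<dots> = density lborel f"
  proof (rule measure_eqI)
    fix A assume "A \<in> sets (distr (density lborel f) borel uminus)"
    then have A [measurable]: "A \<in> sets borel" by simp
    have "uminus -` A \<in> sets (borel :: 'b measure)" using measurable_sets_borel[OF _ A, of uminus] by simp
    then have "emeasure (distr (density lborel f) borel uminus) A = (\<integral>\<^sup>+x. f (- x) * indicator A (- x) \<partial>lborel)"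
      by (simp add: emeasure_distr emeasure_density f indicator_def if_distrib cong: if_cong)
    also have "\<dots> = (\<integral>\<^sup>+x. f x * indicator A x \<partial>distr lborel borel uminus)"
      by (subst nn_integral_distr) auto
    also have "\<dots> = emeasure (density lborel f) A" by (simp add: lb emeasure_density)
    finally show "emeasure (distr (density lborel f) borel uminus) A = emeasure (density lborel f) A" .
  qed simp
  finally show ?thesis by (simp add: d)
qed

context
  fixes W :: "(real \<Rightarrow> real^'d) measure"
  assumes W: "wiener_measure W"
begin

lemma wiener_simps: "space W = C0" "sets W = sets (sigma C0 {U. openin ucc_topology U})"
    "brownian_motion W (\<lambda>s \<omega>. \<omega> s)" "brownian_motion W (\<lambda>s \<omega>. \<omega> (- s))"
  using W by (auto simp: wiener_measure_def)

interpretation prob_space W using W by (simp add: wiener_measure_def)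

lemma wiener_coordinate: "(\<lambda>w. w r) \<in> borel_measurable W"
proof (cases "0 \<le> r")
  case True then show ?thesis using wiener_simps(3) by (simp add: brownian_motion_def)
next
  case False
  then have "0 \<le> - r" by simp
  then have "(\<lambda>w. w (- (- r))) \<in> borel_measurable W" using wiener_simps(4) unfolding brownian_motion_def by blast
  then show ?thesis by simp
qed

lemma wiener_set_incr: "(\<lambda>w. set_incr A w) \<in> borel_measurable W"
  unfolding set_incr_def incr_def by (intro borel_measurable_diff wiener_coordinate)

text \<open>
  An interval is cut at time \<open>0\<close> into a part \<open>Y\<close> after and a part \<open>Z\<close>
  before \<open>0\<close> (the latter measured along the reversed path). Either kind is independent by the
  Brownian property of its half, and the two halves are independent of each other.
\<close>

lemma wiener_indep:
  assumes P: "finite P" "P \<subseteq> half_open" "disjoint P"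
  shows "indep_vars (\<lambda>_. borel) (\<lambda>A w. set_incr A w) P"
proof -
  define Y where "Y A w = w (max 0 (Sup A)) - w (max 0 (Inf A))" for A :: "real set" and w :: "real \<Rightarrow> real^'d"
  define Z where "Z A w = w (- (max 0 (- Inf A))) - w (- (max 0 (- Sup A)))" for A :: "real set" and w :: "real \<Rightarrow> real^'d"
  have ab: "\<exists>a b. A = {a<..b} \<and> a < b" if "A \<in> P" for A using that P by (auto simp: half_open_def)
  have io: "A = {Inf A<..Sup A} \<and> Inf A < Sup A" if "A \<in> P" for A using ab[OF that] by auto
  have dj: "A \<inter> B = {}" if "A \<in> P" "B \<in> P" "A \<noteq> B" for A B using P that by (auto simp: disjoint_def)
  have "indep_vars (\<lambda>_. borel) Y P"
    unfolding Y_def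
  proof (rule brownian_increments_indep[OF wiener_simps(3) P(1)])
    show "disjoint_family_on (\<lambda>A. {max 0 (Inf A)<..max 0 (Sup A)}) P"
      unfolding disjoint_family_on_def
    proof (intro ballI impI)
      fix A B assume AB: "A \<in> P" "B \<in> P" "A \<noteq> B"
      have "{max 0 (Inf A)<..max 0 (Sup A)} \<subseteq> {Inf A<..Sup A}" for A :: "real set" by auto
      then show "{max 0 (Inf A)<..max 0 (Sup A)} \<inter> {max 0 (Inf B)<..max 0 (Sup B)} = {}"
        using dj[OF AB] io[OF AB(1)] io[OF AB(2)] by blast
    qed
  qed (use io in \<open>force simp: max_def\<close>)
  moreover have "indep_vars (\<lambda>_. borel) Z P"
    unfolding Z_def
  proof (rule brownian_increments_indep[OF wiener_simps(4) P(1)])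
    show "disjoint_family_on (\<lambda>A. {max 0 (- Sup A)<..max 0 (- Inf A)}) P"
      unfolding disjoint_family_on_def
    proof (intro ballI impI)
      fix A B assume AB: "A \<in> P" "B \<in> P" "A \<noteq> B"
      have False if "x \<in> {max 0 (- Sup A)<..max 0 (- Inf A)}" "x \<in> {max 0 (- Sup B)<..max 0 (- Inf B)}" for x
      proof -
        \<comment> \<open>Time reversal makes the intervals closed on the left instead, but they stay disjoint: if two of them
        met, the originals would share their smaller right end point.\<close>
        have "Inf A < min (Sup A) (Sup B)" "Inf B < min (Sup A) (Sup B)"
          using that io[OF AB(1)] io[OF AB(2)] by (auto simp: max_def split: if_splits)
        then have "min (Sup A) (Sup B) \<in> A \<inter> B"
          by (subst io[OF AB(1), THEN conjunct1], subst io[OF AB(2), THEN conjunct1]) auto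
        then show False using dj[OF AB] by blast
      qed
      then show "{max 0 (- Sup A)<..max 0 (- Inf A)} \<inter> {max 0 (- Sup B)<..max 0 (- Inf B)} = {}" by blast
    qed
  qed (use io in \<open>force simp: max_def\<close>)
  moreover have "indep_var (PiM P (\<lambda>_. borel)) (\<lambda>w. \<lambda>A\<in>P. Y A w) (PiM P (\<lambda>_. borel)) (\<lambda>w. \<lambda>A\<in>P. Z A w)"
  proof -
    define f where "f u v y = (\<lambda>A\<in>P. y (u A) - y (v A))" for u v :: "real set \<Rightarrow> real" and y :: "real \<Rightarrow> real^'d"
    have f: "f u v \<in> PiM {0..} (\<lambda>_. borel) \<rightarrow>\<^sub>M PiM P (\<lambda>_. borel)" if "\<And>A. 0 \<le> u A" "\<And>A. 0 \<le> v A" for u v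
      unfolding f_def using that by (intro measurable_restrict borel_measurable_diff measurable_component_singleton) auto
    have "indep_var (PiM {0..} (\<lambda>_. borel)) (\<lambda>\<omega>. \<lambda>s\<in>{0..}. \<omega> s) (PiM {0..} (\<lambda>_. borel)) (\<lambda>\<omega>. \<lambda>s\<in>{0..}. \<omega> (- s))"
      using W by (simp add: wiener_measure_def)
    from indep_var_compose[OF this f f, of "\<lambda>A. max 0 (Sup A)" "\<lambda>A. max 0 (Inf A)" "\<lambda>A. max 0 (- Inf A)" "\<lambda>A. max 0 (- Sup A)"]
    show ?thesis by (simp add: f_def comp_def Y_def Z_def)
  qed
  ultimately have "indep_vars (\<lambda>_. borel) (\<lambda>A w. Y A w - Z A w) P"
    by (rule indep_vars_combine[OF P(1), where g="\<lambda>y z. y - z"]) (simp add: split_beta)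
  moreover have "Y A w - Z A w = set_incr A w" for A w
  proof -
    have m: "- max 0 (- x) = min 0 x" for x :: real by (auto simp: max_def min_def)
    have "w (max 0 x) + w (min 0 x) = w x + w 0" for x by (cases "0 \<le> x") (auto simp: max_def min_def)
    from this[of "Sup A"] this[of "Inf A"] show ?thesis
      unfolding Y_def Z_def m set_incr_def incr_def by (simp add: algebra_simps)
  qed
  ultimately show ?thesis by simp
qed

text \<open>
  On either side of \<open>0\<close> the law is the given Gaussian one. An increment across \<open>0\<close>
  is a sum of two independent pieces, and \<open>w (b - a) - w 0\<close> splits into independent pieces
  of the same two lengths.
\<close>

lemma wiener_law:
  assumes "a < b"
  shows "distr W borel (\<lambda>w. w b - w a) = distr W borel (\<lambda>w. w (b - a) - w 0)"
proof -
  let ?d = "\<lambda>s x. ennreal (\<Prod>i\<in>UNIV. normal_density 0 (sqrt s) ((x :: real^'d) $ i))"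
  have pos: "distributed W lborel (\<lambda>w. w u - w s) (?d (u - s))" if "0 \<le> s" "s < u" for s u
    using wiener_simps(3) that by (simp add: brownian_motion_def)
  have neg: "distributed W lborel (\<lambda>w. w (- u) - w (- s)) (?d (u - s))" if "0 \<le> s" "s < u" for s u
    using wiener_simps(4) that by (simp add: brownian_motion_def)
  have law: "distr W borel X = density lborel f" if "distributed W lborel X f" for X :: "_ \<Rightarrow> real^'d" and f
    using distributed_distr_eq_density[OF that] by (simp cong: distr_cong)
  have right: "distr W borel (\<lambda>w. w u - w s) = distr W borel (\<lambda>w. w (u - s) - w 0)" if "0 \<le> s" "s < u" for s u
    using law[OF pos[OF that]] law[OF pos[of 0 "u - s"]] that by simp
  have left: "distr W borel (\<lambda>w. w u - w s) = distr W borel (\<lambda>w. w (u - s) - w 0)" if "s < u" "u \<le> 0" for s u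
  proof -
    have D: "distributed W lborel (\<lambda>w. w s - w u) (?d (u - s))" using neg[of "- u" "- s"] that by simp
    have "distr W borel (\<lambda>w. - (w s - w u)) = distr W borel (\<lambda>w. w s - w u)"
      by (rule distr_uminus_even_density[OF D]) (simp add: normal_density_def)
    then show ?thesis using law[OF D] law[OF pos[of 0 "u - s"]] that by simp
  qed
  consider "0 \<le> a" | "b \<le> 0" | "a < 0" "0 < b" by linarith
  then show ?thesis
  proof cases
    case 3
    define U V :: "bool \<Rightarrow> real set" where "U i = (if i then {0<..b} else {a<..0})" and "V i = (if i then {0<..b} else {b<..b - a})" for i
    have ne: "inj U" "inj V" using 3 by (auto simp: inj_def U_def V_def set_eq_iff)
    have "indep_vars (\<lambda>_. borel) (\<lambda>A w. set_incr A w :: real^'d) (range U)" "indep_vars (\<lambda>_. borel) (\<lambda>A w. set_incr A w :: real^'d) (range V)"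
      using 3 by (auto intro!: wiener_indep half_openI simp: U_def V_def UNIV_bool disjoint_def)
    then have "indep_vars (\<lambda>_. borel) (\<lambda>i w. set_incr (U i) w :: real^'d) UNIV" "indep_vars (\<lambda>_. borel) (\<lambda>i w. set_incr (V i) w :: real^'d) UNIV"
      using indep_vars_reindex_inj ne by blast+
    then have "distr W (PiM UNIV (\<lambda>_. borel)) (\<lambda>w. \<lambda>i\<in>UNIV. set_incr (U i) w) = distr W (PiM UNIV (\<lambda>_. borel)) (\<lambda>w. \<lambda>i\<in>UNIV. set_incr (V i) w :: real^'d)"
    proof (rule indep_vars_same_joint_law)
      show "distr W borel (\<lambda>w. set_incr (U i) w) = distr W borel (\<lambda>w. set_incr (V i) w)" for i
        using 3 left[of a 0] right[of b "b - a"] by (cases i) (simp_all add: U_def V_def)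
    qed
    then have "distr (distr W (PiM UNIV (\<lambda>_. borel)) (\<lambda>w. \<lambda>i\<in>UNIV. set_incr (U i) w)) borel (\<lambda>y. y True + y False)
      = distr (distr W (PiM UNIV (\<lambda>_. borel)) (\<lambda>w. \<lambda>i\<in>UNIV. set_incr (V i) w :: real^'d)) borel (\<lambda>y. y True + y False)" by simp
    moreover have "(\<lambda>w. \<lambda>i\<in>UNIV. set_incr (f i) w :: real^'d) \<in> W \<rightarrow>\<^sub>M PiM UNIV (\<lambda>_. borel)" for f :: "bool \<Rightarrow> real set"
      by (intro measurable_restrict wiener_set_incr)
    ultimately show ?thesis using 3
      by (subst (asm) (1 2) distr_distr) (simp_all add: comp_def U_def V_def)
  qed (rule right left; use assms in simp)+
qed

lemma scattered_field_wiener: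
  "scattered_field W half_open (\<lambda>A w. set_incr A w) (\<lambda>A. Sup A - Inf A) (\<lambda>l. swap_time t l) (\<lambda>l. tau1 t l) (\<lambda>l. unstraddled t l)"
proof unfold_locales
  show "distr W borel (\<lambda>w. set_incr A w) = distr W borel (\<lambda>w. set_incr B w)"
    if AB: "A \<in> half_open" "B \<in> half_open" "Sup A - Inf A = Sup B - Inf B" for A B
  proof -
    obtain a b c d where "A = {a<..b}" "a < b" "B = {c<..d}" "c < d"
      using AB(1,2) by (auto simp: half_open_def)
    with AB(3) wiener_law[of a b] wiener_law[of c d] show ?thesis by simp
  qed
  show "\<exists>P. finite P \<and> disjoint P \<and> {} \<notin> P \<and> P \<subseteq> unstraddled t l \<and>
      (\<forall>A\<in>D. \<forall>\<omega>. set_incr A \<omega> = (\<Sum>Q | Q \<in> P \<and> Q \<subseteq> A. set_incr Q \<omega> :: real^'d))" if "finite D" "D \<subseteq> half_open" for D l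
    by (rule half_open_refine[OF that, of t l]) blast
  show "unstraddled t l \<subseteq> half_open" for l by (auto simp: unstraddled_def half_open_def)
  show "tau1 t l w \<in> space W" if "w \<in> space W" for w l using that tau1_C0 by (simp add: wiener_simps)
qed (rule wiener_set_incr wiener_indep surj_swap_time unstraddled_vimage | assumption)+

end

section \<open>Borel sets of path space and null sets\<close>

text \<open>
  Paths that stay close to \<open>q\<close> during \<open>[a, b]\<close>. Testing rational times only makes
  this set visibly an event in countably many coordinates; by continuity it constrains all times in the
  interior (\<open>tubeD\<close>).
\<close>

definition tube :: "real \<Rightarrow> real \<Rightarrow> real^'d \<Rightarrow> real \<Rightarrow> (real \<Rightarrow> real^'d) set" where
  "tube a b q e = {g \<in> C0. \<forall>x\<in>\<rat>. a \<le> x \<and> x \<le> b \<longrightarrow> dist (g x) q \<le> e}"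

lemma tubeD:
  assumes h: "h \<in> tube a b q e" and y: "a < y" "y < b"
  shows "dist (h y) q \<le> e"
proof (rule ccontr)
  assume "\<not> dist (h y) q \<le> e"
  define S where "S = {a<..<b} \<inter> {z. e < dist (h z) q}"
  have "continuous_on UNIV h" using h by (simp add: tube_def C0_def)
  then have "open S" unfolding S_def
    by (intro open_Int open_greaterThanLessThan open_Collect_less continuous_intros)
  moreover have "y \<in> S \<inter> closure \<rat>"
    using y \<open>\<not> dist (h y) q \<le> e\<close> by (simp add: S_def Rats_closure_real)
  ultimately have "S \<inter> \<rat> \<noteq> {}" using open_Int_closure_eq_empty[of S \<rat>] by blast
  then show False using h by (auto simp: S_def tube_def)
qed

lemma sets_tube:
  assumes "space N = C0" "\<And>r. (\<lambda>w. w r) \<in> borel_measurable N"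
  shows "tube a b q e \<in> sets N"
proof -
  have "{g \<in> space N. \<forall>x\<in>\<rat>. a \<le> x \<and> x \<le> b \<longrightarrow> dist (g x) q \<le> e} \<in> sets N"
  proof (rule sets.sets_Collect_countable_All')
    fix x
    have [measurable]: "(\<lambda>w. w x) \<in> borel_measurable N" by fact
    show "{g \<in> space N. a \<le> x \<and> x \<le> b \<longrightarrow> dist (g x) q \<le> e} \<in> sets N" by measurable
  qed (rule countable_rat)
  then show ?thesis by (simp add: tube_def assms(1))
qed

definition tubes :: "(real^'d) set \<Rightarrow> (real \<Rightarrow> real^'d) set set" where
  "tubes Q = {tube a b q e | a b q e. a \<in> \<rat> \<and> b \<in> \<rat> \<and> q \<in> Q \<and> e \<in> \<rat>}"

lemma countable_tubes: "countable Q \<Longrightarrow> countable (tubes Q)"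
proof -
  assume Q: "countable Q"
  have "tubes Q = (\<lambda>(a, b, q, e). tube a b q e) ` (\<rat> \<times> \<rat> \<times> Q \<times> \<rat>)"
    by (force simp: tubes_def)
  then show ?thesis using Q countable_rat by (auto intro!: countable_image countable_SIGMA)
qed

lemma tube_near:
  fixes f g :: "real \<Rightarrow> real^'d"
  assumes fg: "f \<in> C0" "g \<in> C0" "dist (f x) (g x) < e"
    and Q: "\<And>S. open S \<Longrightarrow> S \<noteq> {} \<Longrightarrow> \<exists>q\<in>Q. q \<in> S"
  shows "\<exists>R\<in>tubes Q. \<exists>I. open I \<and> x \<in> I \<and> g \<in> R \<and> (\<forall>h\<in>R. \<forall>y\<in>I. dist (f y) (h y) < e)"
proof -
  define d where "d = (e - dist (f x) (g x)) / 8"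
  have d: "d > 0" using fg(3) by (simp add: d_def)
  have "isCont f x" "isCont g x" using fg by (auto simp: C0_def continuous_on_eq_continuous_at)
  note cont = this[unfolded continuous_at_eps_delta, rule_format, OF d]
  obtain s1 where s1: "s1 > 0" "\<And>y. dist y x < s1 \<Longrightarrow> dist (f y) (f x) < d"
    using cont(1) by blast
  obtain s2 where s2: "s2 > 0" "\<And>y. dist y x < s2 \<Longrightarrow> dist (g y) (g x) < d"
    using cont(2) by blast
  define s where "s = min s1 s2"
  have s: "s > 0" using s1 s2 by (simp add: s_def)
  obtain a where a: "a \<in> \<rat>" "x - s < a" "a < x" using Rats_dense_in_real[of "x - s" x] s by auto
  obtain b where b: "b \<in> \<rat>" "x < b" "b < x + s" using Rats_dense_in_real[of x "x + s"] s by auto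
  obtain q where q: "q \<in> Q" "dist (g x) q < d" using Q[of "ball (g x) d"] d by auto
  obtain r where r: "r \<in> \<rat>" "2 * d < r" "r < 3 * d" using Rats_dense_in_real[of "2 * d" "3 * d"] d by auto
  have fy: "dist (f y) (f x) < d" and gy: "dist (g y) (g x) < d" if "a \<le> y" "y \<le> b" for y
    using that a b s1(2)[of y] s2(2)[of y] by (auto simp: dist_real_def s_def)
  have "tube a b q r \<in> tubes Q" using a b q r by (auto simp: tubes_def)
  moreover have "g \<in> tube a b q r"
    unfolding tube_def
  proof (intro CollectI conjI ballI impI)
    fix y assume "a \<le> y \<and> y \<le> b"
    then show "dist (g y) q \<le> r" using gy[of y] q r dist_triangle[of "g y" q "g x"] by auto
  qed (rule fg)
  moreover have "dist (f y) (h y) < e" if h: "h \<in> tube a b q r" and y: "y \<in> {a<..<b}" for h y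
  proof -
    have "dist (h y) q \<le> r" using tubeD[OF h] y by auto
    moreover have "dist (f y) (h y) \<le> dist (f y) (f x) + dist (f x) (g x) + dist (g x) q + dist (h y) q"
      using dist_triangle[of "f y" "h y" "f x"] dist_triangle[of "f x" "h y" "g x"] dist_triangle[of "g x" "h y" q]
      by (simp add: dist_commute)
    moreover have "8 * d = e - dist (f x) (g x)" by (simp add: d_def)
    ultimately show ?thesis using fy[of y] y q r d by auto
  qed
  ultimately show ?thesis using a b by (intro bexI[of _ "tube a b q r"] exI[of _ "{a<..<b}"]) auto
qed

text \<open>
  Finite intersections of tubes with rational data are countably many sets, not open themselves, that fit
  between any point and any of its open neighbourhoods. In a neighbourhood of \<open>g\<close> given by a
  compact \<open>K\<close>, every \<open>x\<in>K\<close> has a tube around the graph of \<open>g\<close> near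
  \<open>x\<close> that fits in, and finitely many of the corresponding open time intervals cover
  \<open>K\<close>.
\<close>

lemma ucc_open_tubes:
  assumes Q: "\<And>S. open S \<Longrightarrow> S \<noteq> {} \<Longrightarrow> \<exists>q\<in>Q. q \<in> S"
    and U: "openin (ucc_topology :: (real \<Rightarrow> real^'d) topology) U" and g: "g \<in> U"
  shows "\<exists>F. finite F \<and> F \<subseteq> tubes Q \<and> g \<in> C0 \<inter> \<Inter>F \<and> C0 \<inter> \<Inter>F \<subseteq> U"
proof -
  let ?B = "{{g \<in> C0. \<forall>x\<in>K. dist (f x) (g x) < e} | f K e. f \<in> C0 \<and> compact K \<and> 0 < e} :: (real \<Rightarrow> real^'d) set set"
  have "generate_topology_on ?B U"
    using U unfolding ucc_topology_def openin_topology_generated_by_iff .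
  then show ?thesis using g
  proof (induction arbitrary: g rule: generate_topology_on.induct)
    case (Int U V)
    obtain F where F: "finite F" "F \<subseteq> tubes Q" "g \<in> C0 \<inter> \<Inter>F" "C0 \<inter> \<Inter>F \<subseteq> U"
      using Int.IH(1)[of g] Int.prems by auto
    obtain G where G: "finite G" "G \<subseteq> tubes Q" "g \<in> C0 \<inter> \<Inter>G" "C0 \<inter> \<Inter>G \<subseteq> V"
      using Int.IH(2)[of g] Int.prems by auto
    have "C0 \<inter> \<Inter>(F \<union> G) \<subseteq> U \<inter> V" using F(4) G(4) by auto
    then show ?case using F G by (intro exI[of _ "F \<union> G"]) auto
  next
    case (UN \<U>)
    then obtain U where "U \<in> \<U>" "g \<in> U" by blast
    then obtain F where F: "finite F" "F \<subseteq> tubes Q" "g \<in> C0 \<inter> \<Inter>F" "C0 \<inter> \<Inter>F \<subseteq> U"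
      using UN.IH[of U g] by auto
    then show ?case using \<open>U \<in> \<U>\<close> by (intro exI[of _ F]) auto
  next
    case (Basis U)
    then obtain f K e where f: "f \<in> C0" "compact K" and U: "U = {g \<in> C0. \<forall>x\<in>K. dist (f x) (g x) < e}" by auto
    have gC: "g \<in> C0" and gK: "\<And>x. x \<in> K \<Longrightarrow> dist (f x) (g x) < e" using Basis(2) U by auto
    have "\<forall>x\<in>K. \<exists>R I. R \<in> tubes Q \<and> open I \<and> x \<in> I \<and> g \<in> R \<and> (\<forall>h\<in>R. \<forall>y\<in>I. dist (f y) (h y) < e)"
      using tube_near[OF f(1) gC gK Q] by meson
    then obtain R where "\<forall>x\<in>K. \<exists>I. R x \<in> tubes Q \<and> open I \<and> x \<in> I \<and> g \<in> R x \<and> (\<forall>h\<in>R x. \<forall>y\<in>I. dist (f y) (h y) < e)"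
      by metis
    then obtain I where RI: "\<And>x. x \<in> K \<Longrightarrow> R x \<in> tubes Q \<and> open (I x) \<and> x \<in> I x \<and> g \<in> R x \<and> (\<forall>h\<in>R x. \<forall>y\<in>I x. dist (f y) (h y) < e)"
      by metis
    obtain C where C: "C \<subseteq> K" "finite C" "K \<subseteq> (\<Union>x\<in>C. I x)"
      by (rule compactE_image[OF f(2), of K I]) (use RI in auto)
    show ?case
    proof (intro exI[of _ "R ` C"] conjI)
      show "C0 \<inter> \<Inter>(R ` C) \<subseteq> U"
      proof
        fix h assume h: "h \<in> C0 \<inter> \<Inter>(R ` C)"
        have "dist (f y) (h y) < e" if y: "y \<in> K" for y
        proof -
          obtain x where "x \<in> C" "y \<in> I x" using y C by auto
          then show ?thesis using RI[of x] C h by auto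
        qed
        then show "h \<in> U" using h by (simp add: U)
      qed
    qed (use C RI gC in auto)
  qed auto
qed

text \<open>
  Arbitrary open sets, being unions of neighbourhoods, are covered by the coordinate
  \<open>\<sigma>\<close>-algebra because countably many intersections of tubes suffice.
\<close>

lemma ucc_open_measurable:
  assumes N: "space N = (C0 :: (real \<Rightarrow> real^'d) set)" "\<And>r. (\<lambda>w. w r) \<in> borel_measurable N"
    and U: "openin ucc_topology U"
  shows "U \<in> sets N"
proof -
  obtain Q :: "(real^'d) set" where Q: "countable Q" "\<And>S. open S \<Longrightarrow> S \<noteq> {} \<Longrightarrow> \<exists>q\<in>Q. q \<in> S"
    using countable_dense_exists by (metis)
  define \<F> where "\<F> = {F. finite F \<and> F \<subseteq> tubes Q \<and> C0 \<inter> \<Inter>F \<subseteq> U}"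
  have "countable \<F>"
    by (rule countable_subset[OF _ countable_Collect_finite_subset[OF countable_tubes[OF Q(1)]]]) (auto simp: \<F>_def)
  moreover have "C0 \<inter> \<Inter>F \<in> sets N" if "F \<in> \<F>" for F
  proof -
    have "F \<subseteq> sets N" "finite F" using that sets_tube[OF N] by (auto simp: \<F>_def tubes_def)
    then have "space N \<inter> \<Inter>F \<in> sets N"
      using sets.finite_INT[of F "\<lambda>A. A" N] by (cases "F = {}") auto
    then show ?thesis by (simp add: N)
  qed
  ultimately have "(\<Union>F\<in>\<F>. C0 \<inter> \<Inter>F) \<in> sets N" by (intro sets.countable_UN'') auto
  moreover have "U = (\<Union>F\<in>\<F>. C0 \<inter> \<Inter>F)"
  proof (intro set_eqI iffI)
    fix g assume "g \<in> U"
    from ucc_open_tubes[OF Q(2) U this] show "g \<in> (\<Union>F\<in>\<F>. C0 \<inter> \<Inter>F)" unfolding \<F>_def by blast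
  qed (auto simp: \<F>_def)
  ultimately show ?thesis by simp
qed

lemma coordinate_sigma_gen:
  assumes D: "\<And>r. r \<in> I \<Longrightarrow> {min 0 r<..max 0 r} \<in> D \<or> r = 0" and r: "r \<in> I"
  shows "(\<lambda>w :: real \<Rightarrow> real^'d. w r) \<in> borel_measurable (sigma_gen C0 D (\<lambda>A w. set_incr A w))"
proof -
  let ?N = "sigma_gen (C0 :: (real \<Rightarrow> real^'d) set) D (\<lambda>A w. set_incr A w)"
  have w0: "w 0 = 0" if "w \<in> space ?N" for w using that by (simp add: C0_def)
  consider "r = 0" | "r > 0" "{0<..r} \<in> D" | "r < 0" "{r<..0} \<in> D" 
    using D[OF r] by (cases "r = 0"; cases "r > 0") (auto simp: min_def max_def)
  then show ?thesis
  proof cases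
    case 1
    then show ?thesis using w0 by (subst measurable_cong[where g="\<lambda>_. 0"]) auto
  next
    case 2
    then have "(\<lambda>w. w r - w 0) \<in> borel_measurable ?N"
      using measurable_sigma_gen[OF 2(2), of "\<lambda>A w. set_incr A w" C0] by simp
    then show ?thesis using w0 by (subst measurable_cong[where g="\<lambda>w. w r - w 0"]) auto
  next
    case 3
    then have "(\<lambda>w. w 0 - w r) \<in> borel_measurable ?N"
      using measurable_sigma_gen[OF 3(2), of "\<lambda>A w. set_incr A w" C0] by simp
    then have "(\<lambda>w. - (w 0 - w r)) \<in> borel_measurable ?N" by (rule borel_measurable_uminus)
    then show ?thesis using w0 by (subst measurable_cong[where g="\<lambda>w. - (w 0 - w r)"]) auto
  qed
qed

text \<open>
  This lets the law of the increments determine the measure of all Borel sets, and hence control the preimages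
  of Borel null sets under the exchange of increments.
\<close>

lemma sets_wiener:
  assumes W: "wiener_measure W"
  shows "sets W = sets (sigma_gen C0 half_open (\<lambda>A w. set_incr A w))"
proof
  let ?N = "sigma_gen (C0 :: (real \<Rightarrow> real^'d) set) half_open (\<lambda>A w. set_incr A w)"
  have "(\<lambda>w. w r) \<in> borel_measurable ?N" for r
    by (rule coordinate_sigma_gen[of UNIV]) (auto intro!: half_openI simp: min_def max_def)
  then have "{U. openin ucc_topology U} \<subseteq> sets ?N" using ucc_open_measurable[of ?N] by auto
  then have "sigma_sets (space ?N) {U. openin ucc_topology U} \<subseteq> sets ?N" by (rule sets.sigma_sets_subset)
  moreover have [simp]: "{U. openin ucc_topology U} \<subseteq> Pow (C0 :: (real \<Rightarrow> real^'d) set)"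
    using openin_subset topspace_ucc_topology by fastforce
  ultimately show "sets W \<subseteq> sets ?N" by (simp add: wiener_simps(2)[OF W] sets_measure_of)
  show "sets ?N \<subseteq> sets W"
    by (rule sets_sigma_gen_subset) (simp_all add: wiener_simps[OF W] wiener_set_incr[OF W])
qed

lemma completion_measure_preserving:
  assumes T: "T \<in> completion M \<rightarrow>\<^sub>M M" and eq: "distr (completion M) M T = M"
  shows "T \<in> completion M \<rightarrow>\<^sub>M completion M" and "distr (completion M) (completion M) T = completion M"
proof -
  show "T \<in> completion M \<rightarrow>\<^sub>M completion M"
    by (rule completion.measurable_completion2[OF T]) (simp add: eq)
  show "distr (completion M) (completion M) T = completion M"
    using completion.completion_distr_eq[OF T] by (simp add: eq)
qed

text \<open>
  Events that agree with an event of \<open>N\<close> up to a null set form a \<open>\<sigma>\<close>-algebra.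
  The completion makes subsets of null sets null.
\<close>

lemma sigma_sets_modification:
  assumes A: "A \<in> sigma_sets \<Omega> G" and N: "space N = \<Omega>" and G: "G \<subseteq> Pow \<Omega>"
    and basic: "\<And>E. E \<in> G \<Longrightarrow> \<exists>F\<in>sets N. sym_diff E F \<in> null_sets (completion M)"
  shows "\<exists>F\<in>sets N. sym_diff A F \<in> null_sets (completion M)"
  using A
proof induction
  case (Basic E) then show ?case by (rule basic)
next
  case Empty then show ?case by (intro bexI[of _ "{}"]) auto
next
  case (Compl E)
  then obtain F where F: "F \<in> sets N" "sym_diff E F \<in> null_sets (completion M)" by auto
  have "E \<subseteq> \<Omega>" using sigma_sets_into_sp[OF G Compl(1)] .
  then have "sym_diff (\<Omega> - E) (\<Omega> - F) \<subseteq> sym_diff E F" by auto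
  then show ?case using F N by (intro bexI[of _ "\<Omega> - F"] null_sets_completion_subset[OF _ F(2)]) auto
next
  case (Union E)
  then obtain F where F: "\<And>i. F i \<in> sets N" "\<And>i. sym_diff (E i) (F i) \<in> null_sets (completion M)" by metis
  have "(\<Union>i. sym_diff (E i) (F i)) \<in> null_sets (completion M)"
    using F(2) by (rule null_sets_UN)
  moreover have "sym_diff (\<Union>i. E i) (\<Union>i. F i) \<subseteq> (\<Union>i. sym_diff (E i) (F i))" by auto
  ultimately have "sym_diff (\<Union>i. E i) (\<Union>i. F i) \<in> null_sets (completion M)"
    by (rule null_sets_completion_subset[rotated])
  then show ?case by (rule bexI) (use F(1) in auto)
qed

lemma augment_modification:
  assumes A: "A \<in> sets (augment (completion M) N)" and N: "space N = space M"
  shows "\<exists>F\<in>sets N. sym_diff A F \<in> null_sets (completion M)"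
proof -
  have sub: "sets N \<union> null_sets (completion M) \<subseteq> Pow (space M)"
    using sets.space_closed[of N] sets.space_closed[of "completion M"] N by (auto simp: null_sets_def)
  have "A \<in> sigma_sets (space M) (sets N \<union> null_sets (completion M))"
    using A sub by (simp add: augment_def)
  then show ?thesis
  proof (rule sigma_sets_modification[OF _ N sub])
    fix E assume "E \<in> sets N \<union> null_sets (completion M)"
    then show "\<exists>F\<in>sets N. sym_diff E F \<in> null_sets (completion M)"
    proof
      assume "E \<in> null_sets (completion M)"
      then show ?thesis by (intro bexI[of _ "{}"]) auto
    qed (intro bexI[of _ E]; simp)
  qed
qed

section \<open>The zero-one law\<close>

lemma vimage_Int_sets:
  assumes "T \<in> M \<rightarrow>\<^sub>M M" "E \<in> sets M" "F \<in> sets M"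
  shows "T -` E \<inter> F \<in> sets M"
proof -
  have "T -` E \<inter> F = (T -` E \<inter> space M) \<inter> F" using sets.sets_into_space[OF assms(3)] by auto
  then show ?thesis using measurable_sets[OF assms(1,2)] assms(3) by simp
qed

lemma sets_pair_measure_mono:
  assumes "sets A \<subseteq> sets C" "sets B \<subseteq> sets D" "space A = space C" "space B = space D"
  shows "sets (A \<Otimes>\<^sub>M B) \<subseteq> sets (C \<Otimes>\<^sub>M D)"
  unfolding sets_pair_measure assms(3,4) using assms(1,2) by (intro sigma_sets_mono') blast

context
  fixes W :: "(real \<Rightarrow> real^'d) measure"
    and lam :: "(real^'m) measure"
    and Q :: "(real \<rightharpoonup> real^'m) measure"
    and t :: real
  assumes W: "wiener_measure W"
    and lam: "sets lam = sets borel_nz" "sigma_finite_measure lam"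
    and Q: "poisson_space lam Q"
    and t: "0 \<le> t"
begin

interpretation wiener: scattered_field W half_open "\<lambda>A w. set_incr A w" "\<lambda>A. Sup A - Inf A"
    "\<lambda>l. swap_time t l" "\<lambda>l. tau1 t l" "\<lambda>l. unstraddled t l"
  by (rule scattered_field_wiener[OF W])

interpretation poisson: scattered_field "completion Q" "sets (lborel \<Otimes>\<^sub>M lam)" "\<lambda>A p. point_count p A" "emeasure (lborel \<Otimes>\<^sub>M lam)"
    "\<lambda>l. map_prod (swap_time t l) id" "\<lambda>l. tau2 t l" "\<lambda>_. sets (lborel \<Otimes>\<^sub>M lam)"
  by (rule scattered_field_poisson[OF lam(2) Q])

lemma space_Q: "space Q = point_functions"
  using Q by (simp add: poisson_space_def)

lemma rectangle_sets: "D \<in> sets borel_nz \<Longrightarrow> {q<..r :: real} \<times> D \<in> sets (lborel \<Otimes>\<^sub>M lam)"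
  by (rule pair_measureI) (auto simp: lam(1))

text \<open>
  The \<open>\<sigma>\<close>-algebra of \<open>Q\<close> is generated by the counts of rectangles; those of
  all measurable sets may generate more, but still only events of the completion.
\<close>

lemma sets_Q: "sets Q \<subseteq> sets (poisson.\<G> (sets (lborel \<Otimes>\<^sub>M lam)))"
proof -
  have "sets Q = sets (sigma_gen point_functions {(s, u, D). s < u \<and> D \<in> sets borel_nz}
                      (\<lambda>(s, u, D) p. point_count p ({s<..u} \<times> D)))"
    using Q by (simp add: poisson_space_def)
  also have "\<dots> \<subseteq> sets (poisson.\<G> (sets (lborel \<Otimes>\<^sub>M lam)))"
    by (rule sets_sigma_gen_subset)
       (use measurable_sigma_gen[OF rectangle_sets] in \<open>auto simp: space_Q\<close>)
  finally show ?thesis .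
qed

lemma sets_W: "sets (wiener.\<G> half_open) = sets W"
  using sets_wiener[OF W] by (simp add: wiener_simps(1)[OF W])

lemma measurable_tau1: "tau1 t l \<in> W \<rightarrow>\<^sub>M W"
  using wiener.measurable_T[of l] by (simp add: sets_W cong: measurable_cong_sets)

lemma tau1_preserves:
  "tau1 t l \<in> completion W \<rightarrow>\<^sub>M completion W" "distr (completion W) (completion W) (tau1 t l) = completion W"
proof -
  have "distr (completion W) W (tau1 t l) = W"
  proof (rule measure_eqI)
    fix E assume "E \<in> sets (distr (completion W) W (tau1 t l))"
    then show "emeasure (distr (completion W) W (tau1 t l)) E = emeasure W E"
      using wiener.measure_preserving[of E l] measurable_tau1[of l]
      by (simp add: distr_completion emeasure_distr wiener.emeasure_eq_measure sets_W)
  qed simp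
  from completion_measure_preserving[OF measurable_completion[OF measurable_tau1] this]
  show "tau1 t l \<in> completion W \<rightarrow>\<^sub>M completion W" "distr (completion W) (completion W) (tau1 t l) = completion W" .
qed

lemma tau2_preserves:
  "tau2 t l \<in> completion Q \<rightarrow>\<^sub>M completion Q" "distr (completion Q) (completion Q) (tau2 t l) = completion Q"
proof -
  have m: "tau2 t l \<in> completion Q \<rightarrow>\<^sub>M Q"
    using measurable_mono[of Q "poisson.\<G> (sets (lborel \<Otimes>\<^sub>M lam))" "completion Q" "completion Q"] sets_Q poisson.measurable_T[of l]
    by auto
  have "distr (completion Q) Q (tau2 t l) = Q"
  proof (rule measure_eqI)
    fix E assume "E \<in> sets (distr (completion Q) Q (tau2 t l))"
    then have E: "E \<in> sets Q" by simp
    then have "emeasure Q E = ennreal (poisson.prob E)"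
      using poisson.emeasure_eq_measure[of E] by simp
    moreover have "poisson.prob (tau2 t l -` E \<inter> space (completion Q)) = poisson.prob E"
      by (rule poisson.measure_preserving) (use E sets_Q in blast)
    ultimately show "emeasure (distr (completion Q) Q (tau2 t l)) E = emeasure Q E"
      using m E by (simp only: emeasure_distr poisson.emeasure_eq_measure)
  qed simp
  from completion_measure_preserving[OF m this]
  show "tau2 t l \<in> completion Q \<rightarrow>\<^sub>M completion Q" "distr (completion Q) (completion Q) (tau2 t l) = completion Q" .
qed

interpretation cW: prob_space "completion W"
  using prob_space.prob_space_completion W by (auto simp: wiener_measure_def)
interpretation WQ: pair_prob_space "completion W" "completion Q" ..

abbreviation "WQ \<equiv> completion W \<Otimes>\<^sub>M completion Q"

lemma space_WQ: "space WQ = C0 \<times> point_functions"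
  by (simp add: space_pair_measure wiener_simps(1)[OF W] space_Q)

lemma tau_preserves: "tau t l \<in> WQ \<rightarrow>\<^sub>M WQ" "distr WQ WQ (tau t l) = WQ"
proof -
  have tau: "tau t l = (\<lambda>(w, p). (tau1 t l w, tau2 t l p))" by (auto simp: tau_def)
  show "tau t l \<in> WQ \<rightarrow>\<^sub>M WQ"
    unfolding tau split_beta
    by (intro measurable_Pair measurable_compose[OF measurable_fst tau1_preserves(1)] measurable_compose[OF measurable_snd tau2_preserves(1)])
  have "sigma_finite_measure (distr (completion Q) (completion Q) (tau2 t l))"
    by (simp add: tau2_preserves(2) poisson.sigma_finite_measure_axioms)
  from pair_measure_distr[OF tau1_preserves(1) tau2_preserves(1) this]
  show "distr WQ WQ (tau t l) = WQ"
    by (simp add: tau tau1_preserves(2) tau2_preserves(2))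
qed

text \<open>
  \<open>past_W\<close> and \<open>past_N s\<close> describe what is observed up to time \<open>t\<close> of
  the path and up to time \<open>s\<close> of the points. \<open>gap_N s\<close> describes all points outside
  the time interval \<open>(t, s]\<close>.
\<close>

definition past_W :: "(real \<Rightarrow> real^'d) measure" where
  "past_W = wiener.\<G> {{a<..b} | a b. a < b \<and> b \<le> t}"

definition past_N :: "real \<Rightarrow> (real \<rightharpoonup> real^'m) measure" where
  "past_N s = poisson.\<G> {{q<..r} \<times> D | q r D. r \<le> s \<and> D \<in> sets borel_nz}"

definition gap_N :: "real \<Rightarrow> (real \<rightharpoonup> real^'m) measure" where
  "gap_N s = poisson.\<G> {{q<..r} \<times> D | q r D. (r \<le> t \<or> s \<le> q) \<and> D \<in> sets borel_nz}"

lemma space_past [simp]: "space past_W = C0" "space (past_N s) = point_functions" "space (gap_N s) = point_functions"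
  by (simp_all add: past_W_def past_N_def gap_N_def space_Q wiener_simps(1)[OF W])

lemma sets_past_W: "sets past_W \<subseteq> sets W"
  unfolding past_W_def by (rule wiener.sets_\<G>) (auto intro: half_openI)

lemma sets_past: "sets past_W \<subseteq> sets (completion W)" "sets (past_N s) \<subseteq> sets (completion Q)" "sets (gap_N s) \<subseteq> sets (completion Q)"
proof -
  show "sets past_W \<subseteq> sets (completion W)" using sets_past_W by auto
  show "sets (past_N s) \<subseteq> sets (completion Q)" "sets (gap_N s) \<subseteq> sets (completion Q)"
    unfolding past_N_def gap_N_def by (rule poisson.sets_\<G>; use rectangle_sets in blast)+
qed

text \<open>
  For large \<open>k\<close> the interval \<open>A\<close> lies in \<open>(t - k, t]\<close> and is moved
  into \<open>(t - 2 k, t - k]\<close>, which ends before \<open>B\<close> begins.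
\<close>

lemma mixing_W:
  assumes E: "E \<in> sets past_W" and F: "F \<in> sets past_W"
  shows "(\<lambda>k. wiener.prob (tau1 t k -` E \<inter> F)) \<longlonglongrightarrow> wiener.prob E * wiener.prob F"
proof (rule wiener.mixing[OF _ _ _ E[unfolded past_W_def] F[unfolded past_W_def]])
  fix A B assume "A \<in> {{a<..b} | a b. a < b \<and> b \<le> t}" "B \<in> {{a<..b} | a b. a < b \<and> b \<le> t}"
  then obtain a b c d where A: "A = {a<..b}" "a < b" "b \<le> t" and B: "B = {c<..d}" "c < d" "d \<le> t" by auto
  have "\<forall>\<^sub>F k in sequentially. max (t - a) (t - c) \<le> real k"
    using filterlim_real_sequentially unfolding filterlim_at_top by blast
  then show "\<forall>\<^sub>F k in sequentially. A \<in> unstraddled t k \<and> swap_time t k -` A \<inter> B = {}"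
  proof (elim eventually_mono)
    fix k assume k: "max (t - a) (t - c) \<le> real k"
    have "A \<in> unstraddled t k" unfolding unstraddled_def
      by (intro CollectI exI[of _ a] exI[of _ b]) (use A k in auto)
    moreover have "swap_time t k -` A = {a - real k<..b - real k}"
      unfolding A(1) by (rule swap_time_vimage_Ioc(3)) (use A k in auto)
    ultimately show "A \<in> unstraddled t k \<and> swap_time t k -` A \<inter> B = {}" using A B k by auto
  qed
qed (auto intro: half_openI)

text \<open>
  For large \<open>k\<close> the part of \<open>A\<close> before \<open>t\<close> is moved far into the past,
  and its part in \<open>(t, s]\<close> stays where it is. This is the reason for the gap: \<open>B\<close>
  avoids both.
\<close>

lemma mixing_N:
  assumes s: "t < s" and E: "E \<in> sets (past_N s)" and F: "F \<in> sets (gap_N s)"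
  shows "(\<lambda>k. poisson.prob (tau2 t k -` E \<inter> F)) \<longlonglongrightarrow> poisson.prob E * poisson.prob F"
proof (rule poisson.mixing[OF _ _ _ E[unfolded past_N_def] F[unfolded gap_N_def]])
  fix A B :: "(real \<times> (real^'m)) set"
  assume "A \<in> {{q<..r} \<times> D | q r D. r \<le> s \<and> D \<in> sets borel_nz}" "B \<in> {{q<..r} \<times> D | q r D. (r \<le> t \<or> s \<le> q) \<and> D \<in> sets borel_nz}"
  then obtain a b C c d D where A: "A = {a<..b} \<times> C" "b \<le> s" "C \<in> sets borel_nz" and B: "B = {c<..d} \<times> D" "d \<le> t \<or> s \<le> c" by auto
  have "\<forall>\<^sub>F k in sequentially. max (t - a) (t - c) \<le> real k"
    using filterlim_real_sequentially unfolding filterlim_at_top by blast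
  then show "\<forall>\<^sub>F k in sequentially. A \<in> sets (lborel \<Otimes>\<^sub>M lam) \<and> map_prod (swap_time t k) id -` A \<inter> B = {}"
  proof (elim eventually_mono)
    fix k assume k: "max (t - a) (t - c) \<le> real k"
    have "False" if "a < swap_time t k x" "swap_time t k x \<le> b" "c < x" "x \<le> d" for x
      using that k s A(2) B(2) by (auto simp: swap_time_def split: if_splits)
    then have "map_prod (swap_time t k) id -` A \<inter> B = {}" unfolding A(1) B(1) by fastforce
    then show "A \<in> sets (lborel \<Otimes>\<^sub>M lam) \<and> map_prod (swap_time t k) id -` A \<inter> B = {}"
      unfolding A(1) using rectangle_sets[OF A(3)] by simp
  qed
qed (use rectangle_sets in blast)+

lemma prob_rectangle:
  assumes "A \<in> sets (completion W)" "B \<in> sets (completion Q)"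
  shows "WQ.prob (A \<times> B) = cW.prob A * poisson.prob B"
  unfolding measure_def poisson.emeasure_pair_measure_Times[OF assms] by (rule enn2real_mult)

lemma mixing_WQ:
  assumes s: "t < s" and E: "E \<in> sets (past_W \<Otimes>\<^sub>M past_N s)" and F: "F \<in> sets (past_W \<Otimes>\<^sub>M gap_N s)"
  shows "(\<lambda>k. WQ.prob (tau t k -` E \<inter> F)) \<longlonglongrightarrow> WQ.prob E * WQ.prob F"
proof (rule WQ.mixing_extends[where G="{A \<times> B | A B. A \<in> sets past_W \<and> B \<in> sets (past_N s)}" 
      and H="{A \<times> B | A B. A \<in> sets past_W \<and> B \<in> sets (gap_N s)}"])
  let ?G = "{A \<times> B | A B. A \<in> sets past_W \<and> B \<in> sets (past_N s)}"
  let ?H = "{A \<times> B | A B. A \<in> sets past_W \<and> B \<in> sets (gap_N s)}"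
  show "Int_stable ?G" "Int_stable ?H" by (rule Int_stable_pair_measure_generator)+
  show sub: "?G \<subseteq> WQ.events" "?H \<subseteq> WQ.events" using sets_past pair_measureI by blast+
  show "E \<in> sigma_sets (space WQ) ?G" "F \<in> sigma_sets (space WQ) ?H"
    using E F by (simp_all add: sets_pair_measure space_WQ)
  show "tau t k -` E \<inter> space WQ \<in> WQ.events" "WQ.prob (tau t k -` E \<inter> space WQ) = WQ.prob E"
    if "E \<in> sigma_sets (space WQ) ?G" for k E
  proof -
    have E: "E \<in> sets WQ" using sets.sigma_sets_subset[OF sub(1)] that by blast
    then show "tau t k -` E \<inter> space WQ \<in> WQ.events" by (rule measurable_sets[OF tau_preserves(1)])
    show "WQ.prob (tau t k -` E \<inter> space WQ) = WQ.prob E"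
      using measure_distr[OF tau_preserves(1) E] by (simp add: tau_preserves(2))
  qed
  show "tau t k x \<in> space WQ" if "x \<in> space WQ" for k x
    using measurable_space[OF tau_preserves(1) that] .
  fix E F assume "E \<in> ?G" "F \<in> ?H"
  then obtain E1 E2 F1 F2 where E: "E = E1 \<times> E2" "E1 \<in> sets past_W" "E2 \<in> sets (past_N s)"
    and F: "F = F1 \<times> F2" "F1 \<in> sets past_W" "F2 \<in> sets (gap_N s)" by blast
  have ev: "tau1 t k -` E1 \<inter> F1 \<in> sets W" "tau2 t k -` E2 \<inter> F2 \<in> sets (completion Q)" for k
    using E F sets_past_W sets_past(2,3)[of s]
    by (auto intro!: vimage_Int_sets[OF measurable_tau1] vimage_Int_sets[OF tau2_preserves(1)])
  have "(\<lambda>k. cW.prob (tau1 t k -` E1 \<inter> F1)) \<longlonglongrightarrow> cW.prob E1 * cW.prob F1"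
    using mixing_W[OF E(2) F(2)] E F sets_past_W ev by (simp add: subset_iff)
  from tendsto_mult[OF this mixing_N[OF s E(3) F(3)]]
  have "(\<lambda>k. WQ.prob ((tau1 t k -` E1 \<inter> F1) \<times> (tau2 t k -` E2 \<inter> F2))) \<longlonglongrightarrow> WQ.prob E * WQ.prob F"
    using E(2,3) F(2,3) sets_past(2,3)[of s] sets_past_W
    by (simp add: E(1) F(1) prob_rectangle ev subset_iff mult_ac)
  moreover have "(tau1 t k -` E1 \<inter> F1) \<times> (tau2 t k -` E2 \<inter> F2) = tau t k -` E \<inter> F" for k
    by (auto simp: E F tau_def)
  ultimately show "(\<lambda>k. WQ.prob (tau t k -` E \<inter> F)) \<longlonglongrightarrow> WQ.prob E * WQ.prob F" by simp
qed

lemma gap_N_antimono: "s \<le> s' \<Longrightarrow> sets (gap_N s') \<subseteq> sets (gap_N s)"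
  unfolding gap_N_def
proof (rule sets_sigma_gen_subset, simp, rule measurable_sigma_gen)
  fix A :: "(real \<times> (real^'m)) set" assume "s \<le> s'" "A \<in> {{q<..r} \<times> D | q r D. (r \<le> t \<or> s' \<le> q) \<and> D \<in> sets borel_nz}"
  then show "A \<in> {{q<..r} \<times> D | q r D. (r \<le> t \<or> s \<le> q) \<and> D \<in> sets borel_nz}" by (blast intro: order_trans)
qed

definition right_N :: "(real \<rightharpoonup> real^'m) measure" where
  "right_N = sigma point_functions (\<Union>s\<in>{t<..}. sets (gap_N s))"

lemma gap_N_Pow: "(\<Union>s\<in>{t<..}. sets (gap_N s)) \<subseteq> Pow point_functions"
  using sets.space_closed[of "gap_N _"] by auto

text \<open>
  As \<open>s\<close> decreases to \<open>t\<close> the gap closes: the number of points after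
  \<open>t\<close> is the supremum of the numbers of points after \<open>t + 1 / (n + 1)\<close>.
\<close>

lemma past_N_right_N: "sets (past_N s) \<subseteq> sets right_N"
  unfolding past_N_def
proof (rule sets_sigma_gen_subset)
  show "space right_N = space (completion Q)" by (simp add: right_N_def gap_N_Pow space_Q)
  have gap: "(\<lambda>p. point_count p ({q<..r} \<times> D)) \<in> borel_measurable right_N"
    if "r \<le> t \<or> u \<le> q" "t < u" "D \<in> sets borel_nz" for q r D u
  proof -
    have "(\<lambda>p. point_count p ({q<..r} \<times> D)) \<in> borel_measurable (gap_N u)"
      unfolding gap_N_def by (rule measurable_sigma_gen) (use that in blast)
    moreover have "sets (gap_N u) \<subseteq> sets right_N" using that by (auto simp: right_N_def gap_N_Pow)
    ultimately show ?thesis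
      using measurable_mono[of borel borel "gap_N u" right_N] by (auto simp: right_N_def gap_N_Pow)
  qed
  fix A :: "(real \<times> (real^'m)) set" assume "A \<in> {{q<..r} \<times> D | q r D. r \<le> s \<and> D \<in> sets borel_nz}"
  then obtain q r D where A: "A = {q<..r} \<times> D" "D \<in> sets borel_nz" by auto
  define B where "B n = {max q (t + 1 / real (Suc n))<..r} \<times> D" for n
  have B: "(\<lambda>p. point_count p (B n)) \<in> borel_measurable right_N" for n
    unfolding B_def by (rule gap[of _ "t + 1 / real (Suc n)"]) (use A in auto)
  have split: "point_count p A = point_count p ({q<..min r t} \<times> D) + (SUP n. point_count p (B n))" for p
  proof -
    let ?F = "\<lambda>A. {r. \<exists>e. p r = Some e \<and> (r, e) \<in> A}"
    have "(SUP n. point_count p (B n)) = emeasure (count_space UNIV) (\<Union>n. ?F (B n))"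
      unfolding point_count_def
    proof (rule SUP_emeasure_incseq)
      have "B m \<subseteq> B n" if "m \<le> n" for m n
      proof -
        have "1 / real (Suc n) \<le> 1 / real (Suc m)" using that by (simp add: frac_le)
        then show ?thesis unfolding B_def by auto
      qed
      then show "incseq (\<lambda>n. ?F (B n))" unfolding incseq_def by blast
    qed simp
    also have "(\<Union>n. ?F (B n)) = ?F ({max q t<..r} \<times> D)"
    proof -
      have "(\<Union>n. B n) = {max q t<..r} \<times> D"
      proof (intro set_eqI iffI)
        fix x assume "x \<in> (\<Union>n. B n)"
        then obtain n where n: "x \<in> B n" by auto
        have "t + 1 / real (Suc n) > t" by simp
        then have "max q t < u" if "max q (t + 1 / real (Suc n)) < u" for u using that by linarith
        then show "x \<in> {max q t<..r} \<times> D" using n by (auto simp: B_def simp del: max_less_iff_conj)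
      next
        fix x assume x: "x \<in> {max q t<..r} \<times> D"
        then have "fst x - t > 0" by auto
        then obtain n where "1 / real (Suc n) < fst x - t" using nat_approx_posE by blast
        then show "x \<in> (\<Union>n. B n)" using x by (cases x) (auto simp: B_def intro!: exI[of _ n])
      qed
      then show ?thesis by blast
    qed
    finally have S: "(SUP n. point_count p (B n)) = point_count p ({max q t<..r} \<times> D)" by (simp add: point_count_def)
    have "point_count p A = emeasure (count_space UNIV) (?F ({q<..min r t} \<times> D) \<union> ?F ({max q t<..r} \<times> D))"
      unfolding point_count_def A(1) by (rule arg_cong[where f="emeasure (count_space UNIV)"]) auto
    also have "\<dots> = point_count p ({q<..min r t} \<times> D) + point_count p ({max q t<..r} \<times> D)"
      unfolding point_count_def by (rule plus_emeasure[symmetric]) auto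
    finally show ?thesis by (simp add: S)
  qed
  show "(\<lambda>p. point_count p A) \<in> borel_measurable right_N"
    unfolding split by (intro borel_measurable_add borel_measurable_SUP B gap[of _ "t + 1"]) (use A in auto)
qed

text \<open>
  For \<open>F\<close> outside the gap \<open>(t, s]\<close>, invariance turns the mixing limit into
  \<open>P(Z \<inter> F) = P(Z) P(F)\<close>. Such \<open>F\<close>, for all \<open>s > t\<close>, form
  an intersection-stable generator of a \<open>\<sigma>\<close>-algebra that contains \<open>Z\<close>. Hence
  \<open>Z\<close> is independent of itself.
\<close>

lemma modification_trivial:
  assumes Z: "\<And>s. t < s \<Longrightarrow> Z \<in> sets (past_W \<Otimes>\<^sub>M past_N s)"
    and inv: "\<And>l. 1 \<le> l \<Longrightarrow> AE \<omega> in WQ. tau t l \<omega> \<in> Z \<longleftrightarrow> \<omega> \<in> Z"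
  shows "WQ.prob Z = 0 \<or> WQ.prob Z = 1"
proof -
  define G where "G = {A \<times> B | A B. A \<in> sets past_W \<and> (\<exists>s>t. B \<in> sets (gap_N s))}"
  have "sets (past_W \<Otimes>\<^sub>M past_N s) \<subseteq> sets WQ" for s
    using sets_past by (intro sets_pair_measure_mono) (auto simp: wiener_simps(1)[OF W] space_Q)
  then have Zev: "Z \<in> WQ.events" using Z[of "t + 1"] by auto
  have indep: "WQ.prob (Z \<inter> F) = WQ.prob F * WQ.prob Z" if FG: "F \<in> G" for F
  proof -
    obtain A B s where F: "F = A \<times> B" "A \<in> sets past_W" "t < s" "B \<in> sets (gap_N s)" using FG unfolding G_def by blast
    then have "F \<in> sets (past_W \<Otimes>\<^sub>M gap_N s)" by simp
    from mixing_WQ[OF F(3) Z[OF F(3)] this]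
    have "(\<lambda>k. WQ.prob (tau t k -` Z \<inter> F)) \<longlonglongrightarrow> WQ.prob Z * WQ.prob F" .
    moreover have "\<forall>\<^sub>F k in sequentially. WQ.prob (tau t k -` Z \<inter> F) = WQ.prob (Z \<inter> F)"
      using eventually_ge_at_top[of 1]
    proof eventually_elim
      case (elim k)
      have Fev: "F \<in> WQ.events"
        unfolding F(1) using F(2,4) sets_past by (intro pair_measureI) blast+
      have "tau t k -` Z \<inter> F \<in> WQ.events" by (rule vimage_Int_sets[OF tau_preserves(1) Zev Fev])
      then show ?case using inv[OF elim] Zev Fev by (intro measure_eq_AE) auto
    qed
    ultimately have "(\<lambda>_::nat. WQ.prob (Z \<inter> F)) \<longlonglongrightarrow> WQ.prob Z * WQ.prob F" by (rule Lim_transform_eventually)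
    then show ?thesis by (simp add: LIMSEQ_const_iff mult.commute)
  qed
  have Gev: "G \<subseteq> WQ.events" unfolding G_def using sets_past pair_measureI by blast
  have "Int_stable G"
  proof (rule Int_stableI)
    fix E F assume "E \<in> G" "F \<in> G"
    then obtain A B s A' B' s' where E: "E = A \<times> B" "A \<in> sets past_W" "t < s" "B \<in> sets (gap_N s)"
      and F: "F = A' \<times> B'" "A' \<in> sets past_W" "t < s'" "B' \<in> sets (gap_N s')" by (auto simp: G_def)
    have "B \<in> sets (gap_N (min s s'))" "B' \<in> sets (gap_N (min s s'))"
      using E F gap_N_antimono[of "min s s'" s] gap_N_antimono[of "min s s'" s'] by auto
    then have "B \<inter> B' \<in> sets (gap_N (min s s'))" "A \<inter> A' \<in> sets past_W" "t < min s s'" using E F by auto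
    then show "E \<inter> F \<in> G" unfolding G_def E(1) F(1) Times_Int_Times by blast
  qed
  have GZ: "A \<times> B \<in> sigma_sets (space WQ) G" if A: "A \<in> sets past_W" and B: "B \<in> sets right_N" for A B
  proof -
    have ApG: "A \<times> point_functions \<in> G"
    proof -
      have "point_functions \<in> sets (gap_N (t + 1))" "t < t + 1" using sets.top[of "gap_N (t + 1)"] by simp_all
      then show ?thesis using A unfolding G_def by blast
    qed
    have "B \<in> sigma_sets point_functions (\<Union>s\<in>{t<..}. sets (gap_N s))" using B by (simp add: right_N_def gap_N_Pow)
    then show ?thesis
    proof induction
      case (Basic B)
      then show ?case using A by (intro sigma_sets.Basic) (auto simp: G_def)
    next
      case Empty show ?case by (simp add: sigma_sets.Empty)
    next
      case (Compl B)
      have "A \<times> (point_functions - B) = A \<times> point_functions - A \<times> B" by auto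
      moreover have "A \<times> point_functions \<in> sigma_sets (space WQ) G" using ApG by (rule sigma_sets.Basic)
      moreover have "G \<subseteq> Pow (space WQ)" using Gev sets.space_closed by blast
      ultimately show ?case
        using sets.Diff[of _ "sigma (space WQ) G"] Compl.IH by (metis sets_measure_of)
    next
      case (Union B)
      have "A \<times> (\<Union>i. B i) = (\<Union>i. A \<times> B i)" by auto
      then show ?case using Union.IH by (auto intro: sigma_sets.Union)
    qed
  qed
  have "Z \<in> sigma_sets (space WQ) {A \<times> B | A B. A \<in> sets past_W \<and> B \<in> sets (past_N (t + 1))}"
    using Z[of "t + 1"] by (simp add: sets_pair_measure space_WQ)
  moreover have "sigma_sets (space WQ) {A \<times> B | A B. A \<in> sets past_W \<and> B \<in> sets (past_N (t + 1))} \<subseteq> sigma_sets (space WQ) G"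
    using GZ past_N_right_N by (intro sigma_sets_mono) blast
  ultimately have ZG: "Z \<in> sigma_sets (space WQ) G" by blast
  have "(\<lambda>k::nat. WQ.prob ((\<lambda>x. x) -` Z \<inter> Z)) \<longlonglongrightarrow> WQ.prob Z * WQ.prob Z"
  proof (rule WQ.setwise_limit_extends[OF \<open>Int_stable G\<close> Gev _ _ _ _ _ _ ZG])
    have ev: "E \<in> WQ.events" "E \<inter> space WQ = E" if "E \<in> sigma_sets (space WQ) G" for E
      using sets.sigma_sets_subset[OF Gev] that sets.sets_into_space by blast+
    show "(\<lambda>x. x) -` E \<inter> space WQ \<in> WQ.events" "WQ.prob ((\<lambda>x. x) -` E \<inter> space WQ) = WQ.prob E"
      if "E \<in> sigma_sets (space WQ) G" for E using ev[OF that] by simp_all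
    show "(\<lambda>k. WQ.prob ((\<lambda>x. x) -` E \<inter> Z)) \<longlonglongrightarrow> WQ.prob E * WQ.prob Z" if "E \<in> G" for E
      using indep[OF that] by (simp add: Int_commute)
  qed (use Zev in auto)
  then have "WQ.prob Z = WQ.prob Z * WQ.prob Z" by (simp add: LIMSEQ_const_iff)
  then show ?thesis by auto
qed

text \<open>
  Null sets were added at three places: to the two factor \<open>\<sigma>\<close>-algebras and to their
  product. They are removed in the opposite order. What remains of the right-continuous Poisson filtration
  lies in \<open>past_N s\<close> for every \<open>s > t\<close>.
\<close>

lemma filt_modification:
  assumes Z: "Z \<in> sets (filt_wp W Q t)"
  obtains Z' where "\<And>s. t < s \<Longrightarrow> Z' \<in> sets (past_W \<Otimes>\<^sub>M past_N s)" "AE \<omega> in WQ. \<omega> \<in> Z' \<longleftrightarrow> \<omega> \<in> Z"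
proof -
  let ?W = "sigma_gen (C0 :: (real \<Rightarrow> real^'d) set) {..t} (\<lambda>r w. w r)"
  let ?S = "\<Inter>s\<in>{t<..}. sets (filt_mu0 s) :: (real \<rightharpoonup> real^'m) set set"
  let ?N = "sigma point_functions ?S"
  have S: "?S \<subseteq> Pow point_functions"
    using sets.space_closed[of "filt_mu0 (t + 1)"] by (force simp: filt_mu0_def)
  have sp: "space ?W = space W" "space ?N = space Q" using S by (simp_all add: wiener_simps(1)[OF W] space_Q)
  have "\<exists>F\<in>sets (filt_B W t \<Otimes>\<^sub>M filt_mu Q t). sym_diff Z F \<in> null_sets (completion WQ)"
    using Z unfolding filt_wp_def wp_space_def
    by (rule augment_modification) (simp add: space_pair_measure filt_B_def filt_mu_def augment_def space_measure_of_conv wiener_simps(1)[OF W] space_Q)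
  then obtain Y where Y: "Y \<in> sets (filt_B W t \<Otimes>\<^sub>M filt_mu Q t)" "sym_diff Z Y \<in> null_sets (completion WQ)" by auto
  have spf: "space (filt_B W t) = space W" "space (filt_mu Q t) = space Q"
    by (simp_all add: filt_B_def filt_mu_def augment_def space_measure_of_conv)
  have "\<exists>F\<in>sets (?W \<Otimes>\<^sub>M ?N). sym_diff Y F \<in> null_sets (completion WQ)"
  proof (rule sigma_sets_modification[OF Y(1)[unfolded sets_pair_measure]])
    show "space (?W \<Otimes>\<^sub>M ?N) = space (filt_B W t) \<times> space (filt_mu Q t)" by (simp add: space_pair_measure sp spf wiener_simps(1)[OF W])
    show "{a \<times> b |a b. a \<in> sets (filt_B W t) \<and> b \<in> sets (filt_mu Q t)} \<subseteq> Pow (space (filt_B W t) \<times> space (filt_mu Q t))"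
      by (auto dest: sets.sets_into_space)
    fix E assume "E \<in> {a \<times> b |a b. a \<in> sets (filt_B W t) \<and> b \<in> sets (filt_mu Q t)}"
    then obtain A B where E: "E = A \<times> B" "A \<in> sets (filt_B W t)" "B \<in> sets (filt_mu Q t)" by auto
    obtain A' where A': "A' \<in> sets ?W" "sym_diff A A' \<in> null_sets (completion W)"
      using augment_modification[OF E(2)[unfolded filt_B_def] sp(1)] by auto
    obtain B' where B': "B' \<in> sets ?N" "sym_diff B B' \<in> null_sets (completion Q)"
      using augment_modification[OF E(3)[unfolded filt_mu_def] sp(2)] by auto
    have "sym_diff A A' \<times> space (completion Q) \<in> null_sets WQ" "space (completion W) \<times> sym_diff B B' \<in> null_sets WQ"
      using A' B' by (auto simp: null_sets_def poisson.emeasure_pair_measure_Times)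
    then have "sym_diff A A' \<times> space (completion Q) \<union> space (completion W) \<times> sym_diff B B' \<in> null_sets (completion WQ)"
      by (intro null_sets.Un null_sets_completionI)
    moreover have "A \<subseteq> space (completion W)" "A' \<subseteq> space (completion W)" "B \<subseteq> space (completion Q)" "B' \<subseteq> space (completion Q)"
      using sets.sets_into_space[OF E(2)] sets.sets_into_space[OF E(3)] sets.sets_into_space[OF A'(1)] sets.sets_into_space[OF B'(1)]
      by (simp_all only: sp spf space_completion)
    then have "sym_diff E (A' \<times> B') \<subseteq> sym_diff A A' \<times> space (completion Q) \<union> space (completion W) \<times> sym_diff B B'"
      unfolding E(1) by auto
    ultimately have "sym_diff E (A' \<times> B') \<in> null_sets (completion WQ)" by (rule null_sets_completion_subset[rotated])
    then show "\<exists>F\<in>sets (?W \<Otimes>\<^sub>M ?N). sym_diff E F \<in> null_sets (completion WQ)"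
      using A' B' by (intro bexI[of _ "A' \<times> B'"]) auto
  qed
  then obtain Z' where Z': "Z' \<in> sets (?W \<Otimes>\<^sub>M ?N)" "sym_diff Y Z' \<in> null_sets (completion WQ)" by auto
  show ?thesis
  proof (rule that[of Z'])
    fix s assume s: "t < s"
    have "sets ?W \<subseteq> sets past_W"
    proof (rule sets_sigma_gen_subset)
      fix r assume "r \<in> {..t}"
      then show "(\<lambda>w. w r) \<in> borel_measurable past_W"
        unfolding past_W_def wiener_simps(1)[OF W]
      proof (rule coordinate_sigma_gen[of "{..t}", rotated])
        show "{min 0 r<..max 0 r} \<in> {{a<..b} | a b. a < b \<and> b \<le> t} \<or> r = 0" if "r \<in> {..t}" for r
        proof -
          have "min 0 r < max 0 r \<and> max 0 r \<le> t" if "r \<noteq> 0" using that \<open>r \<in> {..t}\<close> t by auto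
          then show ?thesis by blast
        qed
      qed
    qed simp
    moreover have "sets ?N \<subseteq> sets (past_N s)"
    proof -
      have "sets (filt_mu0 s) \<subseteq> sets (past_N s)"
        unfolding filt_mu0_def
      proof (rule sets_sigma_gen_subset)
        fix i :: "real \<times> real \<times> (real^'m) set"
        assume "i \<in> {(q, r, D). q \<le> r \<and> r \<le> s \<and> D \<in> sets borel_nz}"
        then obtain q r D where i: "i = (q, r, D)" "r \<le> s" "D \<in> sets borel_nz" by auto
        have "(\<lambda>p. point_count p ({q<..r} \<times> D)) \<in> borel_measurable (past_N s)"
          unfolding past_N_def by (rule measurable_sigma_gen) (use i in blast)
        then show "(case i of (q, r, D) \<Rightarrow> \<lambda>p. point_count p ({q<..r} \<times> D)) \<in> borel_measurable (past_N s)"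
          by (simp add: i)
      qed simp
      then have "?S \<subseteq> sets (past_N s)" using s by (intro INF_lower2[of s]) auto
      then have "sigma_sets (space (past_N s)) ?S \<subseteq> sets (past_N s)" by (rule sets.sigma_sets_subset)
      then show ?thesis by (simp only: sets_measure_of[OF S] space_past)
    qed
    ultimately have "sets (?W \<Otimes>\<^sub>M ?N) \<subseteq> sets (past_W \<Otimes>\<^sub>M past_N s)"
      by (rule sets_pair_measure_mono) (simp_all only: sp space_past wiener_simps(1)[OF W] space_Q)
    then show "Z' \<in> sets (past_W \<Otimes>\<^sub>M past_N s)" using Z'(1) by (rule subsetD)
  next
    have "AE \<omega> in completion WQ. \<omega> \<in> Z' \<longleftrightarrow> \<omega> \<in> Z"
      using AE_not_in[OF Y(2)] AE_not_in[OF Z'(2)]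
    proof eventually_elim
      case (elim \<omega>) then show ?case by blast
    qed
    then show "AE \<omega> in WQ. \<omega> \<in> Z' \<longleftrightarrow> \<omega> \<in> Z" unfolding AE_completion_iff .
  qed
qed

text \<open>
  Since \<open>tau t l\<close> preserves the measure, the preimage of the null set where \<open>Z\<close>
  and its modification differ is null, so the modification inherits the invariance.
\<close>

theorem zero_one_law:
  assumes Z: "Z \<in> sets (filt_wp W Q t)"
    and inv: "\<And>l. 1 \<le> l \<Longrightarrow> AE \<omega> in wp_space W Q. tau t l \<omega> \<in> Z \<longleftrightarrow> \<omega> \<in> Z"
  shows "(AE \<omega> in wp_space W Q. \<omega> \<in> Z) \<or> (AE \<omega> in wp_space W Q. \<omega> \<notin> Z)"
proof -
  obtain Z' where Z': "\<And>s. t < s \<Longrightarrow> Z' \<in> sets (past_W \<Otimes>\<^sub>M past_N s)" and ae: "AE \<omega> in WQ. \<omega> \<in> Z' \<longleftrightarrow> \<omega> \<in> Z"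
    using filt_modification[OF Z] by blast
  have "AE \<omega> in WQ. tau t l \<omega> \<in> Z' \<longleftrightarrow> \<omega> \<in> Z'" if "1 \<le> l" for l
  proof -
    have "AE \<omega> in distr WQ WQ (tau t l). \<omega> \<in> Z' \<longleftrightarrow> \<omega> \<in> Z" unfolding tau_preserves(2) by (rule ae)
    from AE_distrD[OF tau_preserves(1) this] ae inv[OF that, unfolded wp_space_def AE_completion_iff]
    show ?thesis by eventually_elim auto
  qed
  from modification_trivial[OF Z' this]
  have "WQ.prob Z' = 0 \<or> WQ.prob Z' = 1" .
  moreover have ev: "Z' \<in> WQ.events"
  proof -
    have "sets (past_W \<Otimes>\<^sub>M past_N (t + 1)) \<subseteq> sets WQ"
      using sets_past by (intro sets_pair_measure_mono) (auto simp: wiener_simps(1)[OF W] space_Q)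
    then show ?thesis using Z'[of "t + 1"] by auto
  qed
  ultimately have "(AE \<omega> in WQ. \<omega> \<notin> Z') \<or> (AE \<omega> in WQ. \<omega> \<in> Z')"
    using WQ.prob_eq_0[OF ev] WQ.prob_eq_1[OF ev] by auto
  then have "(AE \<omega> in WQ. \<omega> \<in> Z) \<or> (AE \<omega> in WQ. \<omega> \<notin> Z)"
  proof
    assume "AE \<omega> in WQ. \<omega> \<notin> Z'"
    with ae have "AE \<omega> in WQ. \<omega> \<notin> Z" by eventually_elim auto
    then show ?thesis ..
  next
    assume "AE \<omega> in WQ. \<omega> \<in> Z'"
    with ae have "AE \<omega> in WQ. \<omega> \<in> Z" by eventually_elim auto
    then show ?thesis ..
  qed
  then show ?thesis unfolding wp_space_def AE_completion_iff .
qed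

end

text \<open>
  The constant is the supremum of all \<open>c\<close> with \<open>f > c\<close> almost surely; boundedness
  makes this set nonempty and bounded above.
\<close>

lemma (in prob_space) AE_const_of_zero_one:
  fixes f :: "'a \<Rightarrow> real"
  assumes bdd: "AE \<omega> in M. \<bar>f \<omega>\<bar> \<le> K"
    and zo: "\<And>c. (AE \<omega> in M. c < f \<omega>) \<or> (AE \<omega> in M. \<not> c < f \<omega>)"
  shows "\<exists>C. AE \<omega> in M. f \<omega> = C"
proof -
  define S where "S = {c. AE \<omega> in M. c < f \<omega>}"
  have "AE \<omega> in M. - K - 1 < f \<omega>" using bdd by eventually_elim auto
  then have ne: "S \<noteq> {}" by (auto simp: S_def)
  have "c \<le> K" if "c \<in> S" for c
  proof -
    have "AE \<omega> in M. c < f \<omega>" using that by (simp add: S_def)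
    with bdd have "AE \<omega> in M. c \<le> K" by eventually_elim auto
    then show ?thesis by simp
  qed
  then have bS: "bdd_above S" by (auto simp: bdd_above_def)
  have "AE \<omega> in M. Sup S - 1 / real (Suc n) < f \<omega> \<and> f \<omega> \<le> Sup S + 1 / real (Suc n)" for n
  proof -
    obtain c where c: "c \<in> S" "Sup S - 1 / real (Suc n) < c"
      using less_cSupE[of "Sup S - 1 / real (Suc n)" S] ne by auto
    have "Sup S + 1 / real (Suc n) \<notin> S" using cSup_upper[OF _ bS, of "Sup S + 1 / real (Suc n)"] by auto
    then have "AE \<omega> in M. \<not> Sup S + 1 / real (Suc n) < f \<omega>" using zo by (auto simp: S_def)
    moreover have "AE \<omega> in M. c < f \<omega>" using c by (simp add: S_def)
    ultimately show ?thesis by eventually_elim (use c in auto)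
  qed
  then have "AE \<omega> in M. \<forall>n. Sup S - 1 / real (Suc n) < f \<omega> \<and> f \<omega> \<le> Sup S + 1 / real (Suc n)"
    by (simp add: AE_all_countable)
  then have "AE \<omega> in M. f \<omega> = Sup S"
  proof eventually_elim
    case (elim \<omega>)
    have "\<not> 0 < \<bar>f \<omega> - Sup S\<bar>"
    proof
      assume "0 < \<bar>f \<omega> - Sup S\<bar>"
      then obtain n where "1 / real (Suc n) < \<bar>f \<omega> - Sup S\<bar>" using nat_approx_posE by blast
      with elim[rule_format, of n] show False by auto
    qed
    then show ?case by simp
  qed
  then show ?thesis ..
qed

theorem lemma3p2:
  fixes W :: "(real \<Rightarrow> real^'d) measure"
    and lam :: "(real^'m) measure"
    and Q :: "(real \<rightharpoonup> real^'m) measure"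
    and \<zeta> :: "(real \<Rightarrow> real^'d) \<times> (real \<rightharpoonup> real^'m) \<Rightarrow> real"
    and t T :: real
  assumes "wiener_measure W"
    and "sets lam = sets borel_nz"
    and "sigma_finite_measure lam"
    and "(\<integral>\<^sup>+ e. ennreal (min 1 ((norm e)\<^sup>2)) \<partial>lam) < \<infinity>"
    and "poisson_space lam Q"
    and "0 < T"
    and "t \<in> {0..T}"
    and "\<zeta> \<in> borel_measurable (filt_wp W Q t)"
    and "\<exists>K. AE \<omega> in wp_space W Q. \<bar>\<zeta> \<omega>\<bar> \<le> K"
    and "\<And>l::nat. 1 \<le> l \<Longrightarrow> AE \<omega> in wp_space W Q. \<zeta> (tau t l \<omega>) = \<zeta> \<omega>"
  shows "\<exists>C::real. AE \<omega> in wp_space W Q. \<zeta> \<omega> = C"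
proof -
  obtain K where K: "AE \<omega> in wp_space W Q. \<bar>\<zeta> \<omega>\<bar> \<le> K" using assms(9) by blast
  have sp: "space (filt_wp W Q t) = space (wp_space W Q)" by (simp add: filt_wp_def augment_def space_measure_of_conv)
  have prob: "prob_space (completion W)" "prob_space (completion Q)"
    using assms(1,5) by (auto simp: wiener_measure_def poisson_space_def poisson_random_measure_def prob_space.prob_space_completion)
  interpret prob_space "wp_space W Q"
    unfolding wp_space_def by (intro prob_space.prob_space_completion prob_space_pair prob)
  show ?thesis
  proof (rule AE_const_of_zero_one[OF K])
    fix c
    let ?Z = "{\<omega> \<in> space (filt_wp W Q t). c < \<zeta> \<omega>}"
    have "(AE \<omega> in wp_space W Q. \<omega> \<in> ?Z) \<or> (AE \<omega> in wp_space W Q. \<omega> \<notin> ?Z)"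
    proof (rule zero_one_law[OF assms(1,2,3,5)])
      show "0 \<le> t" using assms(7) by simp
      show "?Z \<in> sets (filt_wp W Q t)" using assms(8) by measurable
      fix l :: nat assume l: "1 \<le> l"
      have T: "tau t l \<omega> \<in> space (wp_space W Q)" if "\<omega> \<in> space (wp_space W Q)" for \<omega>
      proof -
        have s: "space (wp_space W Q) = C0 \<times> point_functions"
          using assms(1,5) by (simp add: wp_space_def space_pair_measure wiener_measure_def poisson_space_def)
        show ?thesis using that unfolding s by (auto simp: tau_def tau1_C0 tau2_point_functions)
      qed
      from assms(10)[OF l] AE_space show "AE \<omega> in wp_space W Q. tau t l \<omega> \<in> ?Z \<longleftrightarrow> \<omega> \<in> ?Z"
        by eventually_elim (simp add: sp T)
    qed
    then show "(AE \<omega> in wp_space W Q. c < \<zeta> \<omega>) \<or> (AE \<omega> in wp_space W Q. \<not> c < \<zeta> \<omega>)"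
      using AE_space[of "wp_space W Q"] by (auto simp: sp elim!: AE_mp)
  qed
qed

end
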